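(* If $G$ is a locally compact group which is nondiscrete but amenable-as-discrete, then $\mathrm{LIM}_0(G)=\mathrm{LIM}(G)$.
   Context: All groups are Hausdorff; $|E|$ is the left Haar measure of $E\subset G$. $G$ is amenable-as-discrete if there is a left-invariant mean on $\ell_\infty(G)$, the space of all bounded functions on $G$ (i.e. $G$ with the discrete topology is amenable). $L_\infty(G)$ is the algebra of bounded locally measurable functions modulo equality off locally null sets, the dual of $L_1(G)$. $M(G)$ is the set of means on $L_\infty(G)$: linear functionals $\mu$ with $\|\mu\|=1$, $\mu\ge0$; write $\mu(E)=\mu(\mathbb 1_E)$. With $l_x\phi(y)=\phi(x^{-1}y)$, $\mathrm{LIM}(G)$ is the set of $\mu\in M(G)$ with $\mu(l_x\phi)=\mu(\phi)$ for all $x\in G$, $\phi\in L_\infty(G)$. For a finite measurable partition $\mathcal P$ of $G$ and $\epsilon\in(0,1)$, $\mathcal N(\mu,\mathcal P,\epsilon)=\{\nu\in M(G):|\mu(E)-\nu(E)|<\epsilon\ \text{for all }E\in\mathcal P\}$. For compact $A\subset G$ with $|A|>0$, $\mu_A=\mathbb 1_A/|A|$, regarded as a mean on $L_\infty(G)$. For finite $K\subset G$ and $\epsilon\in(0,1)$, $\mathscr C^+(K,\epsilon)$ is the set of compact $A\subset G$ with $|A|>0$ and $|xA\,\triangle\,A|/|A|<\epsilon$ for each $x\in K$. Then $\mathrm{LIM}_0(G)$ is the set of $\mu\in\mathrm{LIM}(G)$ such that for all finite measurable partitions $\mathcal P$ of $G$, finite sets $K\subset G$ and $\epsilon\in(0,1)$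 there exists $A\in\mathscr C^+(K,\epsilon)$ with $\mu_A\in\mathcal N(\mu,\mathcal P,\epsilon)$ (i.e. $\mu$ is a limit point of a Følner net). *)

theory Defs
  imports "HOL-Analysis.Analysis"
begin

text \<open>
  Groups are written additively, but they are not assumed commutative: the class
  \<^class>\<open>topological_group_add\<close> extends \<^class>\<open>group_add\<close>. So \<open>x + y\<close> is the product \<open>xy\<close>,
  \<open>0\<close> the identity, \<open>- x\<close> the inverse and \<open>(+) x ` A\<close> the left translate \<open>xA\<close>.
\<close>

definition left_haar_measure :: "'a::{topological_group_add, t2_space} measure \<Rightarrow> bool" where
  "left_haar_measure M \<longleftrightarrow>
     sets M = sets borel \<and>
     emeasure M UNIV \<noteq> 0 \<and>
     (\<forall>K. compact K \<longrightarrow> emeasure M K < \<infinity>) \<and>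
     (\<forall>E\<in>sets borel. emeasure M E = (INF U\<in>{U. open U \<and> E \<subseteq> U}. emeasure M U)) \<and>
     (\<forall>U. open U \<longrightarrow> emeasure M U = (SUP K\<in>{K. compact K \<and> K \<subseteq> U}. emeasure M K)) \<and>
     (\<forall>x. \<forall>E\<in>sets borel. emeasure M ((+) x ` E) = emeasure M E)"


subsection \<open>Means on bounded functions modulo null sets\<close>

text \<open>
  \<open>V\<close> is a space of bounded real functions and \<open>N\<close> an ideal of null sets. A functional on
  \<open>V\<close> modulo equality off \<open>N\<close> is represented by a functional on \<open>V\<close> that does not distinguish
  functions equal off a set in \<open>N\<close>; it is made extensional so that functionals are determined
  by their values on \<open>V\<close>.
\<close>

definition ess_norm :: "'a set set \<Rightarrow> ('a \<Rightarrow> real) \<Rightarrow> real" where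
  "ess_norm N \<phi> = Inf {c. 0 \<le> c \<and> {x. c < \<bar>\<phi> x\<bar>} \<in> N}"

definition linear_functionals ::
    "('a \<Rightarrow> real) set \<Rightarrow> 'a set set \<Rightarrow> (('a \<Rightarrow> real) \<Rightarrow> real) set" where
  "linear_functionals V N = {\<mu> \<in> extensional V.
     (\<forall>\<phi>\<in>V. \<forall>\<psi>\<in>V. {x. \<phi> x \<noteq> \<psi> x} \<in> N \<longrightarrow> \<mu> \<phi> = \<mu> \<psi>) \<and>
     (\<forall>\<phi>\<in>V. \<forall>\<psi>\<in>V. \<mu> (\<lambda>x. \<phi> x + \<psi> x) = \<mu> \<phi> + \<mu> \<psi>) \<and>
     (\<forall>c. \<forall>\<phi>\<in>V. \<mu> (\<lambda>x. c * \<phi> x) = c * \<mu> \<phi>)}"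

definition functional_norm ::
    "('a \<Rightarrow> real) set \<Rightarrow> 'a set set \<Rightarrow> (('a \<Rightarrow> real) \<Rightarrow> real) \<Rightarrow> ennreal" where
  "functional_norm V N \<mu> = (SUP \<phi>\<in>{\<phi> \<in> V. ess_norm N \<phi> \<le> 1}. ennreal \<bar>\<mu> \<phi>\<bar>)"

definition means :: "('a \<Rightarrow> real) set \<Rightarrow> 'a set set \<Rightarrow> (('a \<Rightarrow> real) \<Rightarrow> real) set" where
  "means V N = {\<mu> \<in> linear_functionals V N.
     functional_norm V N \<mu> = 1 \<and>
     (\<forall>\<phi>\<in>V. {x. \<phi> x < 0} \<in> N \<longrightarrow> 0 \<le> \<mu> \<phi>)}"

definition left_translate :: "'a::group_add \<Rightarrow> ('a \<Rightarrow> real) \<Rightarrow> 'a \<Rightarrow> real" where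
  "left_translate x \<phi> = (\<lambda>y. \<phi> (- x + y))"

definition left_invariant_means ::
    "('a::group_add \<Rightarrow> real) set \<Rightarrow> 'a set set \<Rightarrow> (('a \<Rightarrow> real) \<Rightarrow> real) set" where
  "left_invariant_means V N =
     {\<mu> \<in> means V N. \<forall>x. \<forall>\<phi>\<in>V. \<mu> (left_translate x \<phi>) = \<mu> \<phi>}"

definition ell_infty :: "('a \<Rightarrow> real) set" where
  "ell_infty = {\<phi>. bounded (range \<phi>)}"

definition amenable_as_discrete :: "'a::group_add itself \<Rightarrow> bool" where
  "amenable_as_discrete _ \<longleftrightarrow>
     left_invariant_means (ell_infty :: ('a \<Rightarrow> real) set) {{}} \<noteq> {}"


subsection \<open>Means on \<open>L\<^sub>\<infinity>(G)\<close>\<close>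

text \<open>Measurable sets are those of the completed Haar measure.\<close>

definition locally_measurable_sets :: "'a::topological_space measure \<Rightarrow> 'a set set" where
  "locally_measurable_sets M = {E. \<forall>K. compact K \<longrightarrow> E \<inter> K \<in> sets (completion M)}"

definition locally_null_sets :: "'a::topological_space measure \<Rightarrow> 'a set set" where
  "locally_null_sets M = {E. \<forall>K. compact K \<longrightarrow> E \<inter> K \<in> null_sets (completion M)}"

definition L_infty :: "'a::topological_space measure \<Rightarrow> ('a \<Rightarrow> real) set" where
  "L_infty M = {\<phi>. bounded (range \<phi>) \<and>
     (\<forall>B\<in>sets borel. \<phi> -` B \<in> locally_measurable_sets M)}"

definition Means :: "'a::topological_space measure \<Rightarrow> (('a \<Rightarrow> real) \<Rightarrow> real) set" where
  "Means M = means (L_infty M) (locally_null_sets M)"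

definition LIM_set :: "'a::topological_group_add measure \<Rightarrow> (('a \<Rightarrow> real) \<Rightarrow> real) set" where
  "LIM_set M = left_invariant_means (L_infty M) (locally_null_sets M)"

definition finite_measurable_partition ::
    "'a::topological_space measure \<Rightarrow> 'a set set \<Rightarrow> bool" where
  "finite_measurable_partition M P \<longleftrightarrow>
     finite P \<and> partition_on UNIV P \<and> P \<subseteq> locally_measurable_sets M"

definition mean_nhd :: "'a::topological_space measure \<Rightarrow> (('a \<Rightarrow> real) \<Rightarrow> real) \<Rightarrow>
    'a set set \<Rightarrow> real \<Rightarrow> (('a \<Rightarrow> real) \<Rightarrow> real) set" where
  "mean_nhd M \<mu> P \<epsilon> =
     {\<nu> \<in> Means M. \<forall>E\<in>P. \<bar>\<mu> (indicat_real E) - \<nu> (indicat_real E)\<bar> < \<epsilon>}"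

definition set_mean :: "'a::topological_space measure \<Rightarrow> 'a set \<Rightarrow> ('a \<Rightarrow> real) \<Rightarrow> real" where
  "set_mean M A =
     (\<lambda>\<phi>\<in>L_infty M. set_lebesgue_integral (completion M) A \<phi> / measure M A)"

definition Folner_sets ::
    "'a::topological_group_add measure \<Rightarrow> 'a set \<Rightarrow> real \<Rightarrow> 'a set set" where
  "Folner_sets M K \<epsilon> = {A. compact A \<and> measure M A > 0 \<and>
     (\<forall>x\<in>K. measure M (sym_diff ((+) x ` A) A) / measure M A < \<epsilon>)}"

definition LIM0_set :: "'a::topological_group_add measure \<Rightarrow> (('a \<Rightarrow> real) \<Rightarrow> real) set" where
  "LIM0_set M = {\<mu> \<in> LIM_set M. \<forall>P K. \<forall>\<epsilon>\<in>{0<..<1}.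
     finite_measurable_partition M P \<longrightarrow> finite K \<longrightarrow>
     (\<exists>A\<in>Folner_sets M K \<epsilon>. set_mean M A \<in> mean_nhd M \<mu> P \<epsilon>)}"

end

theory Submission
  imports Defs
begin

text \<open>
  Let \<open>\<mu>\<close> be an invariant mean, and let a finite partition, a finite set \<open>K\<close> and \<open>\<epsilon>\<close> be given. Since
  \<open>G\<close> is amenable as a discrete group, it has a nonempty finite set \<open>F\<close> that is almost invariant
  under \<open>K\<close> in the counting sense (\<open>discrete_folner_set\<close>). If \<open>U\<close> is a set whose translates
  \<open>f + U\<close> for \<open>f \<in> F\<close> are disjoint, then \<open>A = F + U\<close> is a Folner set with the same constants,
  whatever \<open>U\<close> is: translating \<open>A\<close> by \<open>x\<close> only permutes copies of \<open>U\<close>, except for the few copies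
  at points of the symmetric difference of \<open>x + F\<close> and \<open>F\<close>. This freedom in the choice of \<open>U\<close> is
  used to imitate \<open>\<mu>\<close>.

  By invariance, \<open>\<mu>(E)\<close> is the mean of the function \<open>y \<mapsto> card {f \<in> F. f + y \<in> E} / card F\<close>. As \<open>y\<close>
  varies there are only finitely many patterns of which \<open>f + y\<close> lies in which part \<open>E\<close>; let \<open>Y v\<close>
  be the set of those \<open>y\<close> with pattern \<open>v\<close>. All these functions are constant on each \<open>Y v\<close>, so
  \<open>\<mu>(E)\<close> is a convex combination of their values on the \<open>Y v\<close>, with weights \<open>\<mu>(Y v)\<close>. A set
  \<open>U\<close> that is a union of pieces \<open>U v \<subseteq> Y v\<close> with measures proportional to \<open>\<mu>(Y v)\<close> gives the same
  convex combination for the share of \<open>E\<close> in \<open>A\<close>.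

  Such pieces exist because \<open>G\<close> is not discrete. Then points are null (\<open>points_null\<close>), hence
  positive measure occurs near arbitrarily many points in general position, and
  there are compact sets of small and almost arbitrary measure. The lemma \<open>separated_translates\<close>
  combines this into pieces whose translates by \<open>F\<close> are all disjoint. The locally null
  \<open>Y v\<close>, which contain no compact set of positive measure, carry no mass and are left out.

  The set \<open>F\<close> is obtained from the invariant mean on \<open>\<ell>\<^sub>\<infinity>(G)\<close> without duality arguments: if there
  were none, some finite \<open>T\<close> would satisfy \<open>card (T + F) \<ge> 2 * card F\<close> for all finite \<open>F\<close>, and
  Hall's marriage theorem would make the group paradoxical.
\<close>

section \<open>Hall's marriage theorem\<close>

text \<open>
  Hall's marriage theorem for infinitely many finite sets, by Rado's argument. A relation that is
  minimal among those satisfying Hall's condition relates each \<open>i\<close> to a single point: if neither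
  \<open>x\<close> nor \<open>y\<close> could be removed from the image of \<open>i\<close>, the two finite sets of indices witnessing
  this would contradict Hall's condition, by counting the union and the intersection of their
  images. Working with the removed pairs turns a minimal relation into a maximal set.
\<close>

lemma hall_selector:
  fixes A :: "'i \<Rightarrow> 'b set"
  assumes fin: "\<And>i. finite (A i)"
    and hall: "\<And>J. finite J \<Longrightarrow> card J \<le> card (\<Union>i\<in>J. A i)"
  shows "\<exists>s. inj s \<and> (\<forall>i. s i \<in> A i)"
proof -
  define R0 where "R0 = Sigma UNIV A"
  define hall_rel where "hall_rel R \<longleftrightarrow> (\<forall>J. finite J \<longrightarrow> card J \<le> card (R `` J))" for R :: "('i \<times> 'b) set"
  define \<W> where "\<W> = {W. W \<subseteq> R0 \<and> hall_rel (R0 - W)}"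
  have fin_image: "finite (R `` J)" if "R \<subseteq> R0" "finite J" for R J
    by (rule finite_subset[of _ "\<Union>i\<in>J. A i"]) (use that fin in \<open>auto simp: R0_def\<close>)
  have "R0 `` J = (\<Union>i\<in>J. A i)" for J
    by (auto simp: R0_def)
  then have "{} \<in> \<W>"
    using hall by (auto simp: \<W>_def hall_rel_def)
  have "\<exists>W\<in>\<W>. \<forall>X\<in>\<W>. W \<subseteq> X \<longrightarrow> X = W"
  proof (rule subset_Zorn_nonempty)
    fix \<C> assume "\<C> \<noteq> {}" and chain: "subset.chain \<W> \<C>"
    then have sub: "\<C> \<subseteq> \<W>"
      by (auto simp: subset.chain_def)
    have "card J \<le> card ((R0 - \<Union>\<C>) `` J)" if "finite J" for J
    proof -
      \<comment> \<open>Only finitely many pairs lie above \<open>J\<close>, so one member of the chain already removes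
        everything that the union removes there.\<close>
      have "finite (\<Union>\<C> \<inter> Sigma J A)"
        using that fin by auto
      then obtain W where W: "W \<in> \<C>" "\<Union>\<C> \<inter> Sigma J A \<subseteq> W"
        using finite_subset_Union_chain[OF _ _ \<open>\<C> \<noteq> {}\<close> chain] by (metis inf_le1)
      then have "(R0 - \<Union>\<C>) `` J = (R0 - W) `` J"
        by (auto simp: R0_def)
      then show ?thesis
        using W sub that by (auto simp: \<W>_def hall_rel_def)
    qed
    then show "\<Union>\<C> \<in> \<W>"
      using sub by (auto simp: \<W>_def hall_rel_def)
  qed (use \<open>{} \<in> \<W>\<close> in auto)
  then obtain W where W: "W \<in> \<W>" and max: "\<And>X. X \<in> \<W> \<Longrightarrow> W \<subseteq> X \<Longrightarrow> X = W"
    by auto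
  define R where "R = R0 - W"
  have R_sub: "R \<subseteq> R0" and R_hall: "\<And>J. finite J \<Longrightarrow> card J \<le> card (R `` J)"
    using W by (auto simp: R_def \<W>_def hall_rel_def)
  have critical: "\<exists>J. finite J \<and> i \<notin> J \<and> card (R `` J \<union> (R `` {i} - {x})) \<le> card J"
    if "(i, x) \<in> R" for i x
  proof -
    have "insert (i, x) W \<notin> \<W>"
      using max[of "insert (i, x) W"] that by (auto simp: R_def)
    moreover have "R - {(i, x)} = R0 - insert (i, x) W" "insert (i, x) W \<subseteq> R0"
      using W that by (auto simp: R_def \<W>_def)
    ultimately have "\<not> hall_rel (R - {(i, x)})"
      by (simp add: \<W>_def)
    then obtain J where J: "finite J" "card ((R - {(i, x)}) `` J) < card J"
      by (auto simp: hall_rel_def)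
    have "i \<in> J"
    proof (rule ccontr)
      assume "i \<notin> J"
      then have "(R - {(i, x)}) `` J = R `` J"
        by auto
      then show False
        using J R_hall[of J] by auto
    qed
    then have "(R - {(i, x)}) `` J = R `` (J - {i}) \<union> (R `` {i} - {x})"
      by auto
    then show ?thesis
      using J \<open>i \<in> J\<close> by (intro exI[of _ "J - {i}"]) auto
  qed
  have unique: "x = y" if x: "(i, x) \<in> R" and y: "(i, y) \<in> R" for i x y
  proof (rule ccontr)
    assume "x \<noteq> y"
    obtain J1 where J1: "finite J1" "i \<notin> J1" "card (R `` J1 \<union> (R `` {i} - {x})) \<le> card J1"
      using critical[OF x] by blast
    obtain J2 where J2: "finite J2" "i \<notin> J2" "card (R `` J2 \<union> (R `` {i} - {y})) \<le> card J2"
      using critical[OF y] by blast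
    define P where "P = R `` J1 \<union> (R `` {i} - {x})"
    define Q where "Q = R `` J2 \<union> (R `` {i} - {y})"
    have fin: "finite P" "finite Q"
      using J1 J2 fin_image[OF R_sub] by (auto simp: P_def Q_def)
    have "Suc (card (J1 \<union> J2)) = card (insert i (J1 \<union> J2))"
      using J1 J2 by simp
    also have "\<dots> \<le> card (R `` insert i (J1 \<union> J2))"
      using J1 J2 by (intro R_hall) auto
    also have "R `` insert i (J1 \<union> J2) = P \<union> Q"
      using \<open>x \<noteq> y\<close> by (auto simp: P_def Q_def)
    finally have "Suc (card (J1 \<union> J2)) \<le> card (P \<union> Q)" .
    moreover have "card (J1 \<inter> J2) \<le> card (P \<inter> Q)"
    proof -
      have "card (J1 \<inter> J2) \<le> card (R `` (J1 \<inter> J2))"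
        using J1 by (intro R_hall) auto
      also have "\<dots> \<le> card (P \<inter> Q)"
        using fin by (intro card_mono) (auto simp: P_def Q_def)
      finally show ?thesis .
    qed
    ultimately show False
      using card_Un_Int[OF fin] card_Un_Int[OF J1(1) J2(1)] J1(3) J2(3)
      by (simp add: P_def Q_def)
  qed
  have "\<exists>x. (i, x) \<in> R" for i
  proof (rule ccontr)
    assume "\<nexists>x. (i, x) \<in> R"
    then have "R `` {i} = {}"
      by blast
    with R_hall[of "{i}"] show False
      by (simp del: Image_singleton_iff)
  qed
  then obtain s where s: "\<And>i. (i, s i) \<in> R"
    by metis
  have "inj s"
  proof (rule injI)
    fix i j assume eq: "s i = s j"
    have "R `` {i, j} \<subseteq> {s i}"
      using unique[OF _ s[of i]] unique[OF _ s[of j]] eq by auto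
    then have "card (R `` {i, j}) \<le> 1"
      using card_mono[of "{s i}"] by simp
    then have "card {i, j} \<le> 1"
      by (meson R_hall finite.intros order_trans)
    then show "i = j"
      by (cases "i = j") simp_all
  qed
  then show ?thesis
    using s R_sub by (auto simp: R0_def)
qed

section \<open>Invariant charges and Folner sets of discrete groups\<close>

text \<open>
  What the proof uses of an invariant mean: its restriction to indicator functions, a finitely
  additive probability on an algebra of sets. Both means, on \<open>\<ell>\<^sub>\<infinity>(G)\<close> and on \<open>L\<^sub>\<infinity>(G)\<close>, are
  treated through this notion.
\<close>

definition invariant_charge :: "'a::group_add set set \<Rightarrow> ('a set \<Rightarrow> real) \<Rightarrow> bool" where
  "invariant_charge \<A> m \<longleftrightarrow>
     algebra UNIV \<A> \<and> (\<forall>E\<in>\<A>. 0 \<le> m E) \<and> m UNIV = 1 \<and>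
     (\<forall>E\<in>\<A>. \<forall>F\<in>\<A>. E \<inter> F = {} \<longrightarrow> m (E \<union> F) = m E + m F) \<and>
     (\<forall>x. \<forall>E\<in>\<A>. (+) x ` E \<in> \<A> \<and> m ((+) x ` E) = m E)"

lemma charge_UN:
  assumes m: "invariant_charge \<A> m" and "finite I"
    and "\<And>i. i \<in> I \<Longrightarrow> S i \<in> \<A>" and "disjoint_family_on S I"
  shows "m (\<Union>i\<in>I. S i) = (\<Sum>i\<in>I. m (S i))"
  using assms(2-)
proof (induction I)
  case empty
  have "{} \<in> \<A>"
    using m by (auto simp: invariant_charge_def algebra_def ring_of_sets_def semiring_of_sets_def
        semiring_of_sets_axioms_def)
  then have "m ({} \<union> {}) = m {} + m {}"
    using m unfolding invariant_charge_def by blast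
  then show ?case by simp
next
  case (insert i I)
  interpret algebra UNIV \<A>
    using m by (simp add: invariant_charge_def)
  have "(\<Union>j\<in>I. S j) \<in> \<A>" "S i \<inter> (\<Union>j\<in>I. S j) = {}"
    using insert by (auto simp: disjoint_family_on_def)
  then have "m (S i \<union> (\<Union>j\<in>I. S j)) = m (S i) + m (\<Union>j\<in>I. S j)"
    using m insert.prems unfolding invariant_charge_def by blast
  then show ?case
    using insert by (simp add: disjoint_family_on_insert)
qed

lemma charge_le_1:
  assumes m: "invariant_charge \<A> m" and "E \<in> \<A>"
  shows "m E \<le> 1"
proof -
  interpret algebra UNIV \<A>
    using m by (simp add: invariant_charge_def)
  have "m (E \<union> (UNIV - E)) = m E + m (UNIV - E)" "0 \<le> m (UNIV - E)"
    using m assms(2) compl_sets unfolding invariant_charge_def by blast+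
  then show ?thesis
    using m by (simp add: invariant_charge_def Un_absorb1)
qed

text \<open>
  Hall's condition holds for two copies of \<open>G\<close>, with \<open>(y, b)\<close> allowed to choose any point of
  \<open>T + y\<close>. An injective choice cuts each copy of \<open>G\<close> into finitely many pieces, one for every
  \<open>t \<in> T\<close>, whose translates by \<open>t\<close> are pairwise disjoint in \<open>G\<close>: a paradoxical decomposition,
  which would give \<open>G\<close> mass at least two.
\<close>

lemma doubling_contradicts_charge:
  fixes m :: "'a::group_add set \<Rightarrow> real" and T :: "'a set"
  assumes m: "invariant_charge UNIV m" and "finite T"
    and doubling: "\<And>F. finite F \<Longrightarrow> 2 * card F \<le> card (\<Union>t\<in>T. (+) t ` F)"
  shows False
proof -
  define A :: "'a \<times> bool \<Rightarrow> 'a set" where "A = (\<lambda>(y, b). (\<lambda>t. t + y) ` T)"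
  have "\<exists>s. inj s \<and> (\<forall>i. s i \<in> A i)"
  proof (rule hall_selector)
    show "finite (A i)" for i
      using \<open>finite T\<close> by (auto simp: A_def split: prod.split)
    fix J :: "('a \<times> bool) set" assume "finite J"
    have "card J \<le> card (fst ` J \<times> (UNIV :: bool set))"
      using \<open>finite J\<close> by (intro card_mono) force+
    also have "\<dots> \<le> card (\<Union>t\<in>T. (+) t ` fst ` J)"
      using doubling[of "fst ` J"] \<open>finite J\<close> by (simp add: card_cartesian_product mult.commute)
    also have "(\<Union>t\<in>T. (+) t ` fst ` J) = (\<Union>i\<in>J. A i)"
      by (force simp: A_def)
    finally show "card J \<le> card (\<Union>i\<in>J. A i)" .
  qed
  then obtain s where "inj s" and s_A: "\<And>i. s i \<in> A i"
    by blast
  have s: "s (y, b) \<in> (\<lambda>t. t + y) ` T" for y b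
    using s_A[of "(y, b)"] by (simp add: A_def)
  define C where "C b t = {y. s (y, b) = t + y}" for b t
  have sum_C: "(\<Sum>t\<in>T. m (C b t)) = 1" for b
  proof -
    have "(\<Union>t\<in>T. C b t) = UNIV"
      using s[of _ b] by (auto simp: C_def)
    moreover have "disjoint_family_on (C b) T"
      by (auto simp: disjoint_family_on_def C_def)
    ultimately show ?thesis
      using charge_UN[OF m \<open>finite T\<close>, of "C b"] m by (simp add: invariant_charge_def)
  qed
  define D where "D = (\<lambda>(b, t). (+) t ` C b t)"
  have "disjoint_family_on D (UNIV \<times> T)"
  proof -
    have D_sub: "D (b, t) \<subseteq> (\<lambda>y. s (y, b)) ` C b t" for b t
      by (auto simp: D_def C_def)
    have disj: "(\<lambda>y. s (y, b)) ` C b t \<inter> (\<lambda>y. s (y, b')) ` C b' t' = {}"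
      if neq: "(b, t) \<noteq> (b', t')" for b t b' t'
    proof (rule ccontr)
      assume "\<not> ?thesis"
      then obtain y y' where "s (y, b) = s (y', b')" "s (y, b) = t + y" "s (y', b') = t' + y'"
        by (auto simp: C_def)
      moreover from this have "(y, b) = (y', b')"
        using injD[OF \<open>inj s\<close>] by metis
      ultimately show False
        using neq by auto
    qed
    show ?thesis
      unfolding disjoint_family_on_def
    proof (intro ballI impI)
      fix i j :: "bool \<times> 'a" assume "i \<noteq> j"
      then show "D i \<inter> D j = {}"
        using D_sub[of "fst i" "snd i"] D_sub[of "fst j" "snd j"]
          disj[of "fst i" "snd i" "fst j" "snd j"] by simp blast
    qed
  qed
  then have "m (\<Union>i\<in>UNIV \<times> T. D i) = (\<Sum>i\<in>UNIV \<times> T. m (D i))"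
    using \<open>finite T\<close> by (intro charge_UN[OF m]) auto
  also have "\<dots> = (\<Sum>b\<in>UNIV. \<Sum>t\<in>T. m (D (b, t)))"
    by (simp add: sum.cartesian_product)
  also have "\<dots> = (\<Sum>b\<in>UNIV. \<Sum>t\<in>T. m (C b t))"
    using m by (simp add: D_def invariant_charge_def)
  also have "\<dots> = 2"
    by (simp add: sum_C)
  finally show False
    using charge_le_1[OF m, of "\<Union>i\<in>UNIV \<times> T. D i"] by simp
qed

text \<open>
  Folner's theorem for the discrete group. If it fails for \<open>K\<close> and \<open>\<epsilon>\<close>, then adding to any
  finite set its translates by \<open>K\<close> enlarges it by the factor \<open>1 + \<epsilon> / 2\<close>. Iterating gives one
  finite set \<open>T\<close> whose translates double every finite set.
\<close>

lemma discrete_folner_set: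
  fixes m :: "'a::group_add set \<Rightarrow> real" and K :: "'a set" and \<epsilon> :: real
  assumes m: "invariant_charge UNIV m" and "finite K" and "0 < \<epsilon>"
  obtains F where "finite F" "F \<noteq> {}"
    "\<And>x. x \<in> K \<Longrightarrow> card (sym_diff ((+) x ` F) F) < \<epsilon> * card F"
proof (rule ccontr)
  note folner = that
  assume "\<not> thesis"
  then have no_folner: "\<exists>x\<in>K. \<epsilon> * card F \<le> card (sym_diff ((+) x ` F) F)" if "finite F" "F \<noteq> {}" for F
    using that folner by (meson linorder_not_le)
  define P where "P A B = (\<Union>a\<in>A. (+) a ` B)" for A B :: "'a set"
  define K0 where "K0 = insert 0 K"
  have fin_P: "finite (P A B)" if "finite A" "finite B" for A B
    using that by (auto simp: P_def)
  have grow: "(1 + \<epsilon> / 2) * card F \<le> card (P K0 F)" if F: "finite F" for F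
  proof (cases "F = {}")
    case False
    then obtain x where x: "x \<in> K" "\<epsilon> * card F \<le> card (sym_diff ((+) x ` F) F)"
      using no_folner[OF F False] by blast
    let ?X = "(+) x ` F"
    have card_X: "card ?X = card F"
      by (simp add: card_image)
    \<comment> \<open>Both differences have the same size, so \<open>?X - F\<close> is half of the symmetric difference.\<close>
    have "card (?X - F) = card (F - ?X)"
      using card_X card_Diff_subset_Int[of ?X F] card_Diff_subset_Int[of F ?X] that
      by (simp add: Int_commute)
    moreover have "card (sym_diff ?X F) = card (?X - F) + card (F - ?X)"
      using F by (intro card_Un_disjoint) auto
    moreover have "card (F \<union> (?X - F)) = card F + card (?X - F)"
      using F by (intro card_Un_disjoint) auto
    moreover have "card (F \<union> (?X - F)) \<le> card (P K0 F)"
    proof (rule card_mono)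
      show "finite (P K0 F)"
        using F \<open>finite K\<close> by (simp add: fin_P K0_def)
      show "F \<union> (?X - F) \<subseteq> P K0 F"
        using x(1) by (auto simp: P_def K0_def)
    qed
    ultimately show ?thesis
      using x by (simp add: algebra_simps)
  qed auto
  define T where "T n = (P K0 ^^ n) {0}" for n
  have fin_T: "finite (T n)" for n
    using \<open>finite K\<close> by (induction n) (auto simp: T_def K0_def fin_P)
  have T_grow: "(1 + \<epsilon> / 2) ^ n * card F \<le> card (P (T n) F)" if "finite F" for n F
  proof (induction n)
    case (Suc n)
    have "P (T (Suc n)) F = P K0 (P (T n) F)"
      by (force simp: T_def P_def image_iff add.assoc)
    moreover have "(1 + \<epsilon> / 2) * ((1 + \<epsilon> / 2) ^ n * card F) \<le> (1 + \<epsilon> / 2) * card (P (T n) F)"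
      using Suc \<open>0 < \<epsilon>\<close> by (intro mult_left_mono) auto
    ultimately show ?case
      using grow[of "P (T n) F"] fin_P[OF fin_T that] by (simp add: mult.assoc)
  qed (simp add: T_def P_def)
  obtain n where n: "2 < (1 + \<epsilon> / 2) ^ n"
    using real_arch_pow[of "1 + \<epsilon> / 2" 2] \<open>0 < \<epsilon>\<close> by auto
  have "2 * card F \<le> card (\<Union>t\<in>T n. (+) t ` F)" if "finite F" for F
  proof -
    have "2 * real (card F) \<le> (1 + \<epsilon> / 2) ^ n * card F"
      using n by (intro mult_right_mono) auto
    with T_grow[OF that, of n] show ?thesis
      unfolding P_def by linarith
  qed
  then show False
    using doubling_contradicts_charge[OF m fin_T] by blast
qed

section \<open>From invariant means to invariant charges\<close>

text \<open>
  The common properties of \<open>\<ell>\<^sub>\<infinity>(G)\<close> with the ideal \<open>{{}}\<close> and of \<open>L\<^sub>\<infinity>(G)\<close> with the ideal of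
  locally null sets that make a positive functional attain its norm at the constant \<open>1\<close>.
\<close>

definition bounded_functions_space :: "('a \<Rightarrow> real) set \<Rightarrow> 'a set set \<Rightarrow> bool" where
  "bounded_functions_space V N \<longleftrightarrow>
     (\<lambda>_. 1) \<in> V \<and> (\<forall>\<phi>\<in>V. \<forall>\<psi>\<in>V. (\<lambda>x. \<phi> x + \<psi> x) \<in> V) \<and> (\<forall>c. \<forall>\<phi>\<in>V. (\<lambda>x. c * \<phi> x) \<in> V) \<and>
     (\<forall>\<phi>\<in>V. bounded (range \<phi>)) \<and> {} \<in> N \<and> (\<forall>A\<in>N. \<forall>B\<subseteq>A. B \<in> N)"

text \<open>
  This serves twice: a mean has total mass one because its norm is one, and the average over a
  compact set has norm one because its total mass is one. Since the infimum defining the essential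
  norm need not be attained without countable unions in \<open>N\<close>, the bound is proved with a factor
  \<open>1 / z\<close> for all \<open>z < 1\<close>.
\<close>

lemma functional_norm_positive:
  assumes space: "bounded_functions_space V N"
    and lin: "\<mu> \<in> linear_functionals V N"
    and pos: "\<And>\<phi>. \<phi> \<in> V \<Longrightarrow> {x. \<phi> x < 0} \<in> N \<Longrightarrow> 0 \<le> \<mu> \<phi>"
  shows "functional_norm V N \<mu> = ennreal (\<mu> (\<lambda>_. 1))"
proof -
  have one: "(\<lambda>_. 1) \<in> V"
    and V_add: "\<And>\<phi> \<psi>. \<phi> \<in> V \<Longrightarrow> \<psi> \<in> V \<Longrightarrow> (\<lambda>x. \<phi> x + \<psi> x) \<in> V"
    and V_scale: "\<And>c \<phi>. \<phi> \<in> V \<Longrightarrow> (\<lambda>x. c * \<phi> x) \<in> V"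
    and bdd: "\<And>\<phi>. \<phi> \<in> V \<Longrightarrow> bounded (range \<phi>)"
    and empty: "{} \<in> N" and N_sub: "\<And>A B. A \<in> N \<Longrightarrow> B \<subseteq> A \<Longrightarrow> B \<in> N"
    using space unfolding bounded_functions_space_def by blast+
  have add: "\<And>\<phi> \<psi>. \<phi> \<in> V \<Longrightarrow> \<psi> \<in> V \<Longrightarrow> \<mu> (\<lambda>x. \<phi> x + \<psi> x) = \<mu> \<phi> + \<mu> \<psi>"
    and scale: "\<And>c \<phi>. \<phi> \<in> V \<Longrightarrow> \<mu> (\<lambda>x. c * \<phi> x) = c * \<mu> \<phi>"
    using lin unfolding linear_functionals_def by blast+
  have one_nonneg: "0 \<le> \<mu> (\<lambda>_. 1)"
    using pos[OF one] empty by simp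
  have bound: "\<bar>\<mu> \<phi>\<bar> \<le> c * \<mu> (\<lambda>_. 1)" if \<phi>: "\<phi> \<in> V" and c: "{x. c < \<bar>\<phi> x\<bar>} \<in> N" for \<phi> c
  proof -
    have "0 \<le> c * \<mu> (\<lambda>_. 1) + s * \<mu> \<phi>" if s: "s = 1 \<or> s = - 1" for s
    proof -
      have "0 \<le> \<mu> (\<lambda>x. c * 1 + s * \<phi> x)"
        using s by (intro pos V_add V_scale \<phi> one N_sub[OF c]) auto
      also have "\<dots> = c * \<mu> (\<lambda>_. 1) + s * \<mu> \<phi>"
        using add[OF V_scale[OF one, of c] V_scale[OF \<phi>, of s]] scale[OF one, of c]
          scale[OF \<phi>, of s] by simp
      finally show ?thesis .
    qed
    from this[of 1] this[of "- 1"] show ?thesis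
      by simp
  qed
  have norm_bound: "\<bar>\<mu> \<phi>\<bar> \<le> \<mu> (\<lambda>_. 1)" if \<phi>: "\<phi> \<in> V" and norm: "ess_norm N \<phi> \<le> 1" for \<phi>
  proof (rule field_le_mult_one_interval)
    fix z :: real assume z: "0 < z" "z < 1"
    let ?S = "{c. 0 \<le> c \<and> {x. c < \<bar>\<phi> x\<bar>} \<in> N}"
    obtain b where b: "\<And>x. \<bar>\<phi> x\<bar> \<le> b"
      using bdd[OF \<phi>] by (auto simp: bounded_iff)
    then have "{x. \<bar>b\<bar> < \<bar>\<phi> x\<bar>} = {}"
      by (force simp: not_less intro: order_trans[OF b])
    then have "\<bar>b\<bar> \<in> ?S"
      using empty by simp
    moreover have "Inf ?S < 1 / z"
    proof -
      have "Inf ?S \<le> 1" "1 < 1 / z"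
        using norm z by (simp_all add: ess_norm_def)
      then show ?thesis
        by (rule le_less_trans)
    qed
    ultimately obtain c where c: "c \<in> ?S" "c < 1 / z"
      using cInf_lessD[of ?S] by blast
    have "z * \<bar>\<mu> \<phi>\<bar> \<le> z * (c * \<mu> (\<lambda>_. 1))"
      using bound[OF \<phi>, of c] c z by (intro mult_left_mono) auto
    also have "\<dots> = (z * c) * \<mu> (\<lambda>_. 1)"
      by simp
    also have "\<dots> \<le> 1 * \<mu> (\<lambda>_. 1)"
      using c z one_nonneg by (intro mult_right_mono) (auto simp: field_simps)
    finally show "z * \<bar>\<mu> \<phi>\<bar> \<le> \<mu> (\<lambda>_. 1)"
      by simp
  qed
  have "ess_norm N (\<lambda>_. 1) \<le> 1"
    unfolding ess_norm_def
  proof (rule cInf_lower)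
    show "1 \<in> {c. 0 \<le> c \<and> {x. c < \<bar>1::real\<bar>} \<in> N}"
      using empty by simp
    show "bdd_below {c. 0 \<le> c \<and> {x. c < \<bar>1::real\<bar>} \<in> N}"
      by (rule bdd_belowI[of _ 0]) simp
  qed
  then show ?thesis
    unfolding functional_norm_def using one norm_bound one_nonneg
    by (intro antisym SUP_least SUP_upper2[of "\<lambda>_. 1"]) (auto simp: ennreal_leI)
qed

lemma invariant_charge_of_mean:
  assumes space: "bounded_functions_space V N"
    and \<mu>: "\<mu> \<in> left_invariant_means V N"
    and alg: "algebra UNIV \<A>" and transl: "\<And>x E. E \<in> \<A> \<Longrightarrow> (+) x ` E \<in> \<A>"
    and ind: "\<And>E. E \<in> \<A> \<Longrightarrow> indicat_real E \<in> V"
  shows "invariant_charge \<A> (\<lambda>E. \<mu> (indicat_real E))"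
  unfolding invariant_charge_def
proof (intro conjI ballI allI impI)
  have lin: "\<mu> \<in> linear_functionals V N" and norm: "functional_norm V N \<mu> = 1"
    and pos: "\<And>\<phi>. \<phi> \<in> V \<Longrightarrow> {x. \<phi> x < 0} \<in> N \<Longrightarrow> 0 \<le> \<mu> \<phi>"
    and inv: "\<And>x \<phi>. \<phi> \<in> V \<Longrightarrow> \<mu> (left_translate x \<phi>) = \<mu> \<phi>"
    using \<mu> by (auto simp: left_invariant_means_def means_def)
  have "\<mu> (\<lambda>_. 1) = 1"
    using functional_norm_positive[OF space lin pos] norm by simp
  moreover have "indicat_real (UNIV :: 'a set) = (\<lambda>_. 1)"
    by auto
  ultimately show "\<mu> (indicat_real UNIV) = 1"
    by (simp only:)
  show "algebra UNIV \<A>" by (fact alg)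
  fix E assume E: "E \<in> \<A>"
  have "{x. indicat_real E x < 0} = {}"
    by (auto simp: indicator_def)
  then show "0 \<le> \<mu> (indicat_real E)"
    using pos[OF ind[OF E]] space by (simp add: bounded_functions_space_def)
  show "\<mu> (indicat_real (E \<union> F)) = \<mu> (indicat_real E) + \<mu> (indicat_real F)"
    if "F \<in> \<A>" "E \<inter> F = {}" for F
  proof -
    have "indicat_real (E \<union> F) = (\<lambda>x. indicat_real E x + indicat_real F x)"
      using that by (auto simp: indicator_def fun_eq_iff)
    then show ?thesis
      using lin ind[OF E] ind[OF \<open>F \<in> \<A>\<close>] by (simp add: linear_functionals_def)
  qed
  fix x :: 'a
  show "(+) x ` E \<in> \<A>" by (rule transl[OF E])
  have "indicat_real ((+) x ` E) = left_translate x (indicat_real E)"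
  proof
    fix y
    have "y \<in> (+) x ` E \<longleftrightarrow> - x + y \<in> E"
      by (metis (no_types) add_minus_cancel image_iff minus_add_cancel)
    then show "indicat_real ((+) x ` E) y = left_translate x (indicat_real E) y"
      by (simp add: left_translate_def indicator_def)
  qed
  then show "\<mu> (indicat_real ((+) x ` E)) = \<mu> (indicat_real E)"
    using inv[OF ind[OF E]] by simp
qed

lemma amenable_as_discrete_charge:
  assumes "amenable_as_discrete TYPE('a::group_add)"
  shows "\<exists>m. invariant_charge (UNIV :: 'a set set) m"
proof -
  obtain \<mu> :: "('a \<Rightarrow> real) \<Rightarrow> real" where \<mu>: "\<mu> \<in> left_invariant_means ell_infty {{}}"
    using assms by (auto simp: amenable_as_discrete_def)
  have "bounded_functions_space (ell_infty :: ('a \<Rightarrow> real) set) {{}}"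
    using bounded_scaleR_comp[where 'b = real]
    by (auto simp: bounded_functions_space_def ell_infty_def bounded_plus_comp)
  then have "invariant_charge UNIV (\<lambda>E. \<mu> (indicat_real E))"
  proof (rule invariant_charge_of_mean[OF _ \<mu>])
    show "algebra UNIV (UNIV :: 'a set set)"
      by (metis Pow_UNIV algebra_Pow)
    show "indicat_real E \<in> ell_infty" for E :: "'a set"
      by (auto simp: ell_infty_def bounded_iff indicator_def intro!: exI[of _ 1])
  qed simp
  then show ?thesis by blast
qed

section \<open>Haar measure and means on bounded measurable functions\<close>

lemma translate_eq_vimage: "(+) x ` E = (+) (- x) -` E" for x :: "'a::group_add"
  by (auto simp: image_iff) (metis add_minus_cancel)

lemma open_translate: "open U \<Longrightarrow> open ((+) x ` U)" for x :: "'a::topological_group_add"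
  unfolding translate_eq_vimage by (intro open_vimage continuous_intros)

lemma compact_translate: "compact K \<Longrightarrow> compact ((+) x ` K)" for x :: "'a::topological_group_add"
  by (intro compact_continuous_image continuous_intros)

context
  fixes M :: "'a::{topological_group_add, t2_space} measure"
  assumes haar: "left_haar_measure M"
begin

lemma sets_haar: "sets M = sets borel"
  using haar by (simp add: left_haar_measure_def)

lemma space_haar: "space M = UNIV"
  using sets_eq_imp_space_eq[OF sets_haar] by simp

lemma borel_haar: "E \<in> sets borel \<Longrightarrow> E \<in> sets M"
  by (simp add: sets_haar)

lemma compact_haar: "compact K \<Longrightarrow> K \<in> sets M"
  by (simp add: borel_haar borel_compact)

lemma open_haar: "open U \<Longrightarrow> U \<in> sets M"
  by (simp add: borel_haar)

lemma emeasure_compact: "compact K \<Longrightarrow> emeasure M K < \<infinity>"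
  using haar by (simp add: left_haar_measure_def)

lemma fmeasurable_compact: "compact K \<Longrightarrow> K \<in> fmeasurable M"
  using emeasure_compact compact_haar by (intro fmeasurableI) auto

lemma translate_haar: "E \<in> sets M \<Longrightarrow> (+) x ` E \<in> sets M"
proof -
  assume "E \<in> sets M"
  moreover have "(+) (- x) \<in> borel \<rightarrow>\<^sub>M borel"
    by (intro borel_measurable_continuous_onI continuous_intros)
  ultimately have "(+) (- x) -` E \<inter> space borel \<in> sets borel"
    by (intro measurable_sets) (auto simp: sets_haar)
  then show ?thesis
    by (simp add: translate_eq_vimage sets_haar)
qed

lemma emeasure_translate: "E \<in> sets M \<Longrightarrow> emeasure M ((+) x ` E) = emeasure M E"
  using haar by (simp add: left_haar_measure_def)

lemma measure_translate: "E \<in> sets M \<Longrightarrow> measure M ((+) x ` E) = measure M E"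
  by (simp add: measure_def emeasure_translate)

lemma translate_completion:
  assumes "E \<in> sets (completion M)"
  shows "(+) x ` E \<in> sets (completion M)"
proof -
  obtain S N N' where *: "E = S \<union> N" "N \<subseteq> N'" "N' \<in> null_sets M" "S \<in> sets M"
    using assms by (rule sets_completionE)
  have "(+) x ` E = (+) x ` S \<union> (+) x ` N" "(+) x ` N \<subseteq> (+) x ` N'"
    using * by auto
  moreover have "(+) x ` N' \<in> null_sets M"
    using * by (auto simp: null_sets_def translate_haar emeasure_translate)
  ultimately show ?thesis
    using * translate_haar by (intro sets_completionI[of _ "(+) x ` S" "(+) x ` N" "(+) x ` N'"])
qed

lemma sigma_algebra_locally_measurable: "sigma_algebra UNIV (locally_measurable_sets M)"
  unfolding sigma_algebra_iff2
proof (intro conjI ballI allI impI)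
  fix E assume "E \<in> locally_measurable_sets M"
  moreover have "(UNIV - E) \<inter> K = K - E \<inter> K" for K
    by auto
  ultimately show "UNIV - E \<in> locally_measurable_sets M"
    by (auto simp: locally_measurable_sets_def compact_haar intro!: sets.Diff)
next
  fix E :: "nat \<Rightarrow> 'a set" assume "range E \<subseteq> locally_measurable_sets M"
  then have "(\<Union>i. E i \<inter> K) \<in> sets (completion M)" if "compact K" for K
    using that by (intro sets.countable_UN) (auto simp: locally_measurable_sets_def)
  then show "(\<Union>i. E i) \<in> locally_measurable_sets M"
    by (simp add: locally_measurable_sets_def Int_UN_distrib2)
qed (auto simp: locally_measurable_sets_def)

lemma translate_locally_measurable:
  assumes E: "E \<in> locally_measurable_sets M"
  shows "(+) x ` E \<in> locally_measurable_sets M"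
  unfolding locally_measurable_sets_def
proof (intro CollectI allI impI)
  fix K :: "'a set" assume "compact K"
  then have "E \<inter> (+) (- x) ` K \<in> sets (completion M)"
    using E by (simp add: locally_measurable_sets_def compact_translate)
  then have "(+) x ` (E \<inter> (+) (- x) ` K) \<in> sets (completion M)"
    by (rule translate_completion)
  also have "(+) x ` (E \<inter> (+) (- x) ` K) = (+) x ` E \<inter> K"
    by (auto simp: image_iff) (metis minus_add_cancel)
  finally show "(+) x ` E \<inter> K \<in> sets (completion M)" .
qed

text \<open>
  Expressing \<open>L\<^sub>\<infinity>(G)\<close> by measurability for a \<open>\<sigma>\<close>-algebra gives its closure under sums and
  multiples.
\<close>

lemma L_infty_iff:
  "\<phi> \<in> L_infty M \<longleftrightarrow>
     bounded (range \<phi>) \<and> \<phi> \<in> borel_measurable (sigma UNIV (locally_measurable_sets M))"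
proof -
  interpret sigma_algebra UNIV "locally_measurable_sets M"
    by (rule sigma_algebra_locally_measurable)
  show ?thesis
    by (simp add: L_infty_def measurable_def sigma_sets_eq)
qed

lemma indicator_L_infty:
  assumes "E \<in> locally_measurable_sets M"
  shows "indicat_real E \<in> L_infty M"
proof -
  interpret sigma_algebra UNIV "locally_measurable_sets M"
    by (rule sigma_algebra_locally_measurable)
  have "bounded (range (indicat_real E))"
    by (auto simp: bounded_iff indicator_def intro!: exI[of _ 1])
  then show ?thesis
    using assms by (simp add: L_infty_iff sigma_sets_eq borel_measurable_indicator)
qed

lemma bounded_functions_space_L_infty:
  "bounded_functions_space (L_infty M) (locally_null_sets M)"
  unfolding bounded_functions_space_def
proof (intro conjI ballI allI impI)
  show "(\<lambda>_. 1) \<in> L_infty M"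
    by (simp add: L_infty_iff)
  show "{} \<in> locally_null_sets M"
    by (simp add: locally_null_sets_def)
  fix A B assume "A \<in> locally_null_sets M" "B \<subseteq> A"
  then show "B \<in> locally_null_sets M"
    by (auto simp: locally_null_sets_def intro: null_sets_completion_subset[of "B \<inter> _" "A \<inter> _"])
qed (auto simp: L_infty_iff intro: bounded_plus_comp
    bounded_scaleR_comp[where 'b = real, unfolded real_scaleR_def])

lemma invariant_charge_LIM:
  assumes "\<mu> \<in> LIM_set M"
  shows "invariant_charge (locally_measurable_sets M) (\<lambda>E. \<mu> (indicat_real E))"
proof (rule invariant_charge_of_mean[OF bounded_functions_space_L_infty])
  show "algebra UNIV (locally_measurable_sets M)"
    using sigma_algebra_locally_measurable by (rule sigma_algebra.axioms(1))
qed (use assms in \<open>auto simp: LIM_set_def translate_locally_measurable indicator_L_infty\<close>)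

text \<open>
  A function in \<open>L\<^sub>\<infinity>(G)\<close> is measurable only locally, but its product with the indicator of a
  compact set is measurable for the completed measure.
\<close>

lemma set_integrable_L_infty:
  assumes \<phi>: "\<phi> \<in> L_infty M" and "compact A"
  shows "set_integrable (completion M) A \<phi>"
proof -
  let ?f = "\<lambda>x. indicator A x *\<^sub>R \<phi> x"
  have A: "A \<in> sets (completion M)"
    using compact_haar[OF \<open>compact A\<close>] by simp
  have "?f \<in> borel_measurable (completion M)"
  proof (rule measurableI)
    fix B :: "real set" assume "B \<in> sets borel"
    then have "\<phi> -` B \<inter> A \<in> sets (completion M)"
      using assms by (simp add: L_infty_def locally_measurable_sets_def)
    moreover have "?f -` B \<inter> space (completion M) =
        \<phi> -` B \<inter> A \<union> (if 0 \<in> B then space (completion M) - A else {})"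
      by (auto simp: indicator_def of_bool_def space_haar split: if_splits)
    ultimately show "?f -` B \<inter> space (completion M) \<in> sets (completion M)"
      using A by auto
  qed simp
  moreover obtain b where "\<And>x. norm (\<phi> x) \<le> b"
    using \<phi> by (auto simp: L_infty_def bounded_iff)
  moreover have "emeasure (completion M) A < \<infinity>"
    using emeasure_compact[OF \<open>compact A\<close>] compact_haar[OF \<open>compact A\<close>] by simp
  ultimately have "integrable (completion M) (\<lambda>x. indicator A x *\<^sub>R ?f x)"
    using A by (intro integrableI_bounded_set_indicator[where B = b])
      (auto simp: indicator_def intro!: AE_I2)
  moreover have "(\<lambda>x. indicator A x *\<^sub>R ?f x) = ?f"
    by (auto simp: indicator_def)
  ultimately show ?thesis
    by (simp add: set_integrable_def)
qed

lemma set_mean_in_Means: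
  assumes "compact A" and pos: "measure M A > 0"
  shows "set_mean M A \<in> Means M"
proof -
  let ?V = "L_infty M" and ?N = "locally_null_sets M" and ?C = "completion M"
  have space: "bounded_functions_space ?V ?N"
    by (rule bounded_functions_space_L_infty)
  have A: "A \<in> sets M"
    by (rule compact_haar[OF \<open>compact A\<close>])
  have val: "set_mean M A \<phi> = (LINT x:A|?C. \<phi> x) / measure M A" if "\<phi> \<in> ?V" for \<phi>
    using that by (simp add: set_mean_def)
  have AE: "AE x in ?C. x \<in> A \<longrightarrow> P x" if "{x. \<not> P x} \<in> ?N" for P
  proof (rule AE_I')
    show "{x. \<not> P x} \<inter> A \<in> null_sets ?C"
      using that \<open>compact A\<close> by (simp add: locally_null_sets_def)
  qed auto
  have lin: "set_mean M A \<in> linear_functionals ?V ?N"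
    unfolding linear_functionals_def
  proof (intro CollectI conjI ballI allI impI)
    show "set_mean M A \<in> extensional ?V"
      by (simp add: set_mean_def)
    fix \<phi> assume \<phi>: "\<phi> \<in> ?V"
    {
      fix \<psi> assume \<psi>: "\<psi> \<in> ?V"
      have "(\<lambda>x. \<phi> x + \<psi> x) \<in> ?V"
        using space \<phi> \<psi> by (simp add: bounded_functions_space_def)
      then show "set_mean M A (\<lambda>x. \<phi> x + \<psi> x) = set_mean M A \<phi> + set_mean M A \<psi>"
        using \<phi> \<psi> set_integral_add(2)[OF set_integrable_L_infty[OF \<phi> \<open>compact A\<close>]
            set_integrable_L_infty[OF \<psi> \<open>compact A\<close>]]
        by (simp add: val add_divide_distrib)
      assume "{x. \<phi> x \<noteq> \<psi> x} \<in> ?N"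
      then have "AE x in ?C. x \<in> A \<longrightarrow> \<phi> x = \<psi> x"
        by (intro AE) simp
      then have "AE x in ?C. indicator A x *\<^sub>R \<phi> x = indicator A x *\<^sub>R \<psi> x"
        by eventually_elim (auto simp: indicator_def)
      then have "(LINT x:A|?C. \<phi> x) = (LINT x:A|?C. \<psi> x)"
        using set_integrable_L_infty[OF \<phi> \<open>compact A\<close>] set_integrable_L_infty[OF \<psi> \<open>compact A\<close>]
        unfolding set_lebesgue_integral_def set_integrable_def
        by (intro integral_cong_AE) auto
      then show "set_mean M A \<phi> = set_mean M A \<psi>"
        using \<phi> \<psi> by (simp add: val)
    }
    fix c :: real
    have "(\<lambda>x. c * \<phi> x) \<in> ?V"
      using space \<phi> by (simp add: bounded_functions_space_def)
    then show "set_mean M A (\<lambda>x. c * \<phi> x) = c * set_mean M A \<phi>"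
      using \<phi> by (simp add: val)
  qed
  have nonneg: "0 \<le> set_mean M A \<phi>" if \<phi>: "\<phi> \<in> ?V" "{x. \<phi> x < 0} \<in> ?N" for \<phi>
  proof -
    have "AE x in ?C. x \<in> A \<longrightarrow> 0 \<le> \<phi> x"
      using \<phi>(2) by (intro AE) (simp add: not_le)
    then have "AE x in ?C. 0 \<le> indicator A x *\<^sub>R \<phi> x"
      by eventually_elim (auto simp: indicator_def)
    then have "0 \<le> (LINT x:A|?C. \<phi> x)"
      unfolding set_lebesgue_integral_def by (rule integral_nonneg_AE)
    then show ?thesis
      using \<phi> by (simp add: val)
  qed
  have "(\<lambda>_. 1) \<in> ?V"
    using space by (simp add: bounded_functions_space_def)
  then have "set_mean M A (\<lambda>_. 1) = 1"
    using A pos by (simp add: val set_lebesgue_integral_def)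
  then have "functional_norm ?V ?N (set_mean M A) = 1"
    using functional_norm_positive[OF space lin nonneg] by simp
  then show ?thesis
    using lin nonneg by (simp add: Means_def means_def)
qed

lemma set_mean_indicator:
  assumes "compact A" and E: "E \<in> locally_measurable_sets M" and AE: "A \<inter> E \<in> sets M"
  shows "set_mean M A (indicat_real E) = measure M (A \<inter> E) / measure M A"
proof -
  have "(\<lambda>x. indicator A x *\<^sub>R indicat_real E x) = indicat_real (A \<inter> E)"
    by (auto simp: indicator_def)
  then have "(LINT x:A|completion M. indicat_real E x) = measure M (A \<inter> E)"
    using AE by (simp add: set_lebesgue_integral_def space_haar)
  then show ?thesis
    using indicator_L_infty[OF E] by (simp add: set_mean_def)
qed

end

section \<open>Small compact sets in nondiscrete groups\<close>

lemma separate_finite: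
  fixes S :: "'a::t2_space set"
  assumes "finite S"
  shows "\<exists>Q. (\<forall>p\<in>S. open (Q p) \<and> p \<in> Q p) \<and> disjoint_family_on Q S"
proof -
  have "\<exists>U V. open U \<and> open V \<and> p \<in> U \<and> q \<in> V \<and> U \<inter> V = {}" if "p \<noteq> q" for p q :: 'a
    using that by (rule hausdorff)
  then obtain U V where UV: "\<And>p q :: 'a. p \<noteq> q \<Longrightarrow>
      open (U p q) \<and> open (V p q) \<and> p \<in> U p q \<and> q \<in> V p q \<and> U p q \<inter> V p q = {}"
    by metis
  define Q where "Q p = (\<Inter>q\<in>S - {p}. U p q \<inter> V q p)" for p
  have "open (U p q \<inter> V q p) \<and> p \<in> U p q \<inter> V q p" if "q \<noteq> p" for p q
    using UV[of p q] UV[of q p] that by (simp add: open_Int)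
  then have "open (Q p) \<and> p \<in> Q p" for p
    using assms by (auto simp: Q_def intro!: open_INT)
  moreover have "Q p \<inter> Q q = {}" if "p \<in> S" "q \<in> S" "p \<noteq> q" for p q
    using that UV[of p q] by (auto simp: Q_def)
  ultimately show ?thesis
    by (intro exI[of _ Q]) (auto simp: disjoint_family_on_def)
qed

text \<open>
  Sets of prescribed measure are only obtained approximately; this turns weights \<open>u i\<close> close to
  \<open>\<delta> * c i\<close> into normalized weights close to \<open>c i\<close>, in the sum over all \<open>i\<close>.
\<close>

lemma normalized_approximation:
  fixes u c :: "'i \<Rightarrow> real"
  assumes "finite I" and nonneg: "\<And>i. i \<in> I \<Longrightarrow> 0 \<le> c i" and sum_c: "(\<Sum>i\<in>I. c i) = 1"
    and "0 < \<delta>" "0 < \<eta>"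
    and approx: "\<And>i. i \<in> I \<Longrightarrow> \<bar>u i - \<delta> * c i\<bar> < \<delta> * min (1 / 2) (\<eta> / 4) / card I"
  shows "0 < (\<Sum>i\<in>I. u i)" and "(\<Sum>i\<in>I. \<bar>u i / (\<Sum>j\<in>I. u j) - c i\<bar>) < \<eta>"
proof -
  define \<kappa> where "\<kappa> = min (1 / 2) (\<eta> / 4)"
  define s where "s = (\<Sum>i\<in>I. u i)"
  have "I \<noteq> {}"
    using sum_c by auto
  then have card_I: "0 < card I"
    using \<open>finite I\<close> by (simp add: card_gt_0_iff)
  have "(\<Sum>i\<in>I. \<bar>u i - \<delta> * c i\<bar>) < (\<Sum>i\<in>I. \<delta> * \<kappa> / card I)"
    using \<open>finite I\<close> \<open>I \<noteq> {}\<close> approx by (intro sum_strict_mono) (auto simp: \<kappa>_def)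
  then have err: "(\<Sum>i\<in>I. \<bar>u i - \<delta> * c i\<bar>) < \<delta> * \<kappa>"
    using card_I by simp
  have "s - \<delta> = (\<Sum>i\<in>I. u i - \<delta> * c i)"
    by (simp add: s_def sum_subtractf sum_c flip: sum_distrib_left)
  then have "\<bar>s - \<delta>\<bar> \<le> (\<Sum>i\<in>I. \<bar>u i - \<delta> * c i\<bar>)"
    by (simp add: sum_abs)
  then have s_err: "\<bar>s - \<delta>\<bar> < \<delta> * \<kappa>"
    using err by linarith
  moreover have "\<delta> * \<kappa> \<le> \<delta> * (1 / 2)"
    using \<open>0 < \<delta>\<close> by (intro mult_left_mono) (auto simp: \<kappa>_def)
  ultimately have s: "\<delta> < 2 * s"
    by (simp add: abs_less_iff)
  then show pos: "0 < (\<Sum>i\<in>I. u i)"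
    using \<open>0 < \<delta>\<close> by (simp add: s_def)
  have "(\<Sum>i\<in>I. \<bar>u i - s * c i\<bar>) \<le> (\<Sum>i\<in>I. \<bar>u i - \<delta> * c i\<bar> + \<bar>s - \<delta>\<bar> * c i)"
  proof (rule sum_mono)
    fix i assume "i \<in> I"
    have "u i - s * c i = (u i - \<delta> * c i) - (s - \<delta>) * c i"
      by (simp add: algebra_simps)
    then show "\<bar>u i - s * c i\<bar> \<le> \<bar>u i - \<delta> * c i\<bar> + \<bar>s - \<delta>\<bar> * c i"
      using abs_triangle_ineq4[of "u i - \<delta> * c i" "(s - \<delta>) * c i"] nonneg[OF \<open>i \<in> I\<close>]
      by (simp add: abs_mult)
  qed
  also have "\<dots> = (\<Sum>i\<in>I. \<bar>u i - \<delta> * c i\<bar>) + \<bar>s - \<delta>\<bar>"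
    by (simp add: sum.distrib sum_c flip: sum_distrib_left)
  also have "\<dots> < 2 * (\<delta> * \<kappa>)"
    using err s_err by linarith
  also have "\<dots> \<le> 2 * (\<delta> * (\<eta> / 4))"
    using \<open>0 < \<delta>\<close> by (intro mult_left_mono) (auto simp: \<kappa>_def)
  also have "\<dots> < s * \<eta>"
    using mult_strict_right_mono[OF s \<open>0 < \<eta>\<close>] by simp
  finally have "(\<Sum>i\<in>I. \<bar>u i - s * c i\<bar>) < s * \<eta>" .
  moreover have "\<bar>u i / s - c i\<bar> = \<bar>u i - s * c i\<bar> / s" for i
  proof -
    have "u i / s - c i = (u i - s * c i) / s"
      using pos by (simp add: s_def diff_divide_distrib)
    then show ?thesis
      using pos by (simp add: s_def abs_divide)
  qed
  ultimately show "(\<Sum>i\<in>I. \<bar>u i / (\<Sum>j\<in>I. u j) - c i\<bar>) < \<eta>"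
    using pos by (simp add: pos_divide_less_eq mult.commute flip: s_def sum_divide_distrib)
qed

context
  fixes M :: "'a::{topological_group_add, t2_space} measure"
  assumes haar: "left_haar_measure M"
begin

text \<open>
  All points have equal measure. If it were positive, a compact neighbourhood of \<open>0\<close> would be
  finite, and in a Hausdorff space this makes \<open>0\<close> an isolated point.
\<close>

lemma points_null:
  assumes lc: "locally_compact_space (euclidean :: 'a topology)"
    and nondiscrete: "(euclidean :: 'a topology) \<noteq> discrete_topology UNIV"
  shows "{x} \<in> null_sets M"
proof (rule ccontr)
  assume "{x} \<notin> null_sets M"
  have point: "measure M {y} = measure M {x}" for y
    using measure_translate[OF haar, of "{x}" "y - x"] compact_haar[OF haar] by simp
  have "0 < measure M {x}"
    using \<open>{x} \<notin> null_sets M\<close> compact_haar[OF haar, of "{x}"] emeasure_compact[OF haar, of "{x}"]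
    by (auto simp: null_sets_def measure_def enn2real_positive_iff zero_less_iff_neq_zero)
  have "\<forall>y::'a. \<exists>U K. open U \<and> compact K \<and> y \<in> U \<and> U \<subseteq> K"
    using lc by (simp add: locally_compact_space_def)
  then obtain U K where U: "open U" "compact K" "(0::'a) \<in> U" "U \<subseteq> K"
    by blast
  have "finite K"
  proof (rule ccontr)
    assume "infinite K"
    obtain n where n: "measure M K < real n * measure M {x}"
      using reals_Archimedean3[OF \<open>0 < measure M {x}\<close>] by meson
    obtain S where S: "finite S" "card S = n" "S \<subseteq> K"
      using infinite_arbitrarily_large[OF \<open>infinite K\<close>] by metis
    have "measure M S = (\<Sum>y\<in>S. measure M {y})"
      using \<open>finite S\<close> compact_haar[OF haar] emeasure_compact[OF haar]
      by (intro measure_eq_sum_singleton) (auto simp: less_top)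
    also have "\<dots> = (\<Sum>y\<in>S. measure M {x})"
      by (intro sum.cong refl point)
    also have "\<dots> = real n * measure M {x}"
      using S by simp
    finally have "real n * measure M {x} \<le> measure M K"
      using measure_mono_fmeasurable[OF \<open>S \<subseteq> K\<close> _ fmeasurable_compact[OF haar \<open>compact K\<close>]]
        compact_haar[OF haar finite_imp_compact[OF \<open>finite S\<close>]] by simp
    then show False
      using n by simp
  qed
  then have "finite (U - {0})"
    using U by (meson finite_Diff finite_subset)
  then have "open (U - (U - {0}))"
    using U by (intro open_Diff finite_imp_closed)
  moreover have "U - (U - {0}) = {0}"
    using U by auto
  ultimately have "open ((+) y ` {0})" for y :: 'a
    using open_translate[of "{0}" y] by (simp only:)
  then have "discrete_topology UNIV = (euclidean :: 'a topology)"
    by (simp add: discrete_topology_unique)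
  then show False
    using nondiscrete by simp
qed

lemma haar_outer_regular:
  assumes E: "E \<in> fmeasurable M" and "0 < e"
  shows "\<exists>U. open U \<and> E \<subseteq> U \<and> U \<in> fmeasurable M \<and> measure M U < measure M E + e"
proof -
  have "E \<in> sets borel"
    using E sets_haar[OF haar] by (auto simp: fmeasurable_def)
  then have "(INF U\<in>{U. open U \<and> E \<subseteq> U}. emeasure M U) = emeasure M E"
    using haar by (simp add: left_haar_measure_def)
  also have "emeasure M E = ennreal (measure M E)"
    using E by (rule emeasure_eq_measure2)
  also have "\<dots> < ennreal (measure M E + e)"
    using \<open>0 < e\<close> by (simp add: ennreal_less_iff)
  finally obtain U where U: "open U" "E \<subseteq> U" "emeasure M U < ennreal (measure M E + e)"
    by (auto simp: INF_less_iff)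
  then have "U \<in> fmeasurable M"
    using open_haar[OF haar] by (intro fmeasurableI) (auto intro: less_trans)
  moreover from this have "measure M U < measure M E + e"
    using U(3) by (simp add: emeasure_eq_measure2 ennreal_less_iff)
  ultimately show ?thesis
    using U by blast
qed

text \<open>
  Inside a compact set, inner regularity comes from outer regularity of the complement.
\<close>

lemma haar_inner_regular:
  assumes E: "E \<in> sets M" "E \<subseteq> K" and "compact K" and "0 < e"
  shows "\<exists>C. compact C \<and> C \<subseteq> E \<and> measure M E - e < measure M C"
proof -
  have K: "K \<in> fmeasurable M"
    by (rule fmeasurable_compact[OF haar \<open>compact K\<close>])
  have fin: "E \<in> fmeasurable M" "K - E \<in> fmeasurable M"
    using K E by (auto intro: fmeasurableI2[OF K] fmeasurable_Diff)
  obtain W where W: "open W" "K - E \<subseteq> W" "W \<in> fmeasurable M" "measure M W < measure M (K - E) + e"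
    using haar_outer_regular[OF fin(2) \<open>0 < e\<close>] by blast
  have "measure M (K - E) = measure M K - measure M E"
    using E K fin by (intro measurable_measure_Diff) auto
  moreover have "measure M K \<le> measure M ((K - W) \<union> W)"
    using K W by (intro measure_mono_fmeasurable fmeasurable.Un fmeasurable_Diff) auto
  moreover have "measure M ((K - W) \<union> W) \<le> measure M (K - W) + measure M W"
    using K W by (intro measure_Un_le) auto
  ultimately have "measure M E - e < measure M (K - W)"
    using W by linarith
  moreover have "compact (K - W)" "K - W \<subseteq> E"
    using W \<open>compact K\<close> by (auto intro: compact_diff)
  ultimately show ?thesis
    by blast
qed

lemma compact_subset_of_nonnull:
  assumes Y: "Y \<in> locally_measurable_sets M" "Y \<notin> locally_null_sets M"
  shows "\<exists>C. compact C \<and> C \<subseteq> Y \<and> 0 < measure M C"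
proof -
  obtain K where K: "compact K" "Y \<inter> K \<notin> null_sets (completion M)"
    using Y(2) by (auto simp: locally_null_sets_def)
  then have meas: "Y \<inter> K \<in> sets (completion M)"
    using Y(1) by (simp add: locally_measurable_sets_def)
  then obtain S N N' where S: "Y \<inter> K = S \<union> N" "N \<subseteq> N'" "N' \<in> null_sets M" "S \<in> sets M"
    by (rule sets_completionE)
  have "S \<notin> null_sets M"
  proof
    assume "S \<in> null_sets M"
    then have "S \<union> N' \<in> null_sets M"
      using S(3) by (rule null_sets.Un)
    then have "Y \<inter> K \<in> null_sets (completion M)"
      using null_sets_completion_subset[OF _ null_sets_completionI, of "Y \<inter> K" "S \<union> N'" M] S
      by (simp add: le_supI2)
    then show False
      using K by blast
  qed
  moreover have "S \<in> fmeasurable M"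
    using S by (intro fmeasurableI2[OF fmeasurable_compact[OF haar \<open>compact K\<close>]]) auto
  ultimately have "0 < measure M S"
    using S by (auto simp: null_sets_def emeasure_eq_measure2 zero_less_measure_iff)
  then obtain C where "compact C" "C \<subseteq> S" "measure M S - measure M S < measure M C"
    using haar_inner_regular[OF S(4) _ \<open>compact K\<close>] S(1) by blast
  then show ?thesis
    using S(1) by auto
qed

context
  assumes points: "\<And>x. {x} \<in> null_sets M"
begin

text \<open>
  Otherwise finitely many open sets, each meeting \<open>C\<close> in a null set, would cover the part of \<open>C\<close>
  outside a small open set around \<open>S\<close>.
\<close>

lemma density_point:
  assumes C: "compact C" "0 < measure M C" and "finite S"
  shows "\<exists>p\<in>C - S. \<forall>W. open W \<longrightarrow> p \<in> W \<longrightarrow> 0 < measure M (C \<inter> W)"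
proof -
  have "(\<Union>x\<in>S. {x}) \<in> null_sets M"
    using \<open>finite S\<close> points by (intro null_sets_UN') (auto simp: countable_finite)
  then have S: "S \<in> null_sets M"
    by simp
  then have "measure M S = 0"
    by (simp add: measure_def null_setsD1)
  moreover obtain W0 where W0: "open W0" "S \<subseteq> W0" "W0 \<in> fmeasurable M" "measure M W0 < measure M S + measure M C"
    using haar_outer_regular[of S] S C(2) by (auto intro: fmeasurableI_null_sets)
  ultimately have "measure M W0 < measure M C"
    by simp
  have Cm: "C \<in> fmeasurable M"
    by (rule fmeasurable_compact[OF haar C(1)])
  have "measure M C \<le> measure M ((C - W0) \<union> W0)"
    using Cm W0 by (intro measure_mono_fmeasurable fmeasurable.Un fmeasurable_Diff) auto
  also have "\<dots> \<le> measure M (C - W0) + measure M W0"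
    using Cm W0 by (intro measure_Un_le) auto
  finally have C': "0 < measure M (C - W0)"
    using \<open>measure M W0 < measure M C\<close> by simp
  show ?thesis
  proof (rule ccontr)
    assume "\<not> ?thesis"
    then have "\<forall>p\<in>C - W0. \<exists>W. open W \<and> p \<in> W \<and> measure M (C \<inter> W) = 0"
      using W0(2) by (metis Diff_iff measure_le_0_iff not_less subsetD)
    then obtain W where W: "\<And>p. p \<in> C - W0 \<Longrightarrow> open (W p) \<and> p \<in> W p \<and> measure M (C \<inter> W p) = 0"
      by metis
    have "compact (C - W0)"
      using C(1) W0(1) by (rule compact_diff)
    then obtain D where D: "D \<subseteq> C - W0" "finite D" "C - W0 \<subseteq> (\<Union>p\<in>D. W p)"
      using W by (elim compactE_image[of _ "C - W0" W]) auto
    have meas: "C \<inter> W p \<in> fmeasurable M" if "p \<in> D" for p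
      using that D(1) W compact_haar[OF haar C(1)] open_haar[OF haar]
      by (intro fmeasurableI2[OF Cm] sets.Int) auto
    have "measure M (C - W0) \<le> measure M (\<Union>p\<in>D. C \<inter> W p)"
      using D Cm W0 meas by (intro measure_mono_fmeasurable fmeasurable.finite_UN) (auto simp: fmeasurable_Diff)
    also have "\<dots> \<le> (\<Sum>p\<in>D. measure M (C \<inter> W p))"
      using D(2) meas by (intro measure_UNION_le) auto
    also have "\<dots> = 0"
      using D(1) W by (intro sum.neutral) auto
    finally show False
      using C' by simp
  qed
qed

text \<open>
  Null points have open neighbourhoods of small measure. Finitely many of them cover \<open>K\<close>, and
  adding them one at a time makes the measure of the covered part of \<open>D\<close> grow in small steps.
\<close>

lemma compact_subset_of_measure:
  assumes D: "D \<in> sets M" "D \<subseteq> K" and "compact K" and t: "0 \<le> t" "t \<le> measure M D" and "0 < e"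
  shows "\<exists>C. compact C \<and> C \<subseteq> D \<and> \<bar>measure M C - t\<bar> < e"
proof -
  have "\<exists>W. open W \<and> x \<in> W \<and> W \<in> fmeasurable M \<and> measure M W < e / 2" for x
  proof -
    have "measure M {x} = 0" "{x} \<in> fmeasurable M"
      using points[of x] by (auto simp: measure_def null_setsD1 intro: fmeasurableI_null_sets)
    then show ?thesis
      using haar_outer_regular[of "{x}" "e / 2"] \<open>0 < e\<close> by auto
  qed
  then obtain W where W: "\<And>x. open (W x)" "\<And>x. x \<in> W x" "\<And>x. W x \<in> fmeasurable M"
      "\<And>x. measure M (W x) < e / 2"
    by metis
  obtain X where X: "finite X" "K \<subseteq> (\<Union>x\<in>X. W x)"
    using \<open>compact K\<close> W by (elim compactE_image[of _ K W]) auto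
  have Dm: "D \<in> fmeasurable M"
    using D by (intro fmeasurableI2[OF fmeasurable_compact[OF haar \<open>compact K\<close>]])
  have "\<exists>S\<in>sets M. S \<subseteq> D \<and> measure M S \<le> t \<and> t - e / 2 < measure M S"
    if "finite X" "t \<le> measure M (D \<inter> (\<Union>x\<in>X. W x))" for X
    using that
  proof (induction X)
    case empty
    then have "t = 0"
      using t by simp
    then show ?case
      using \<open>0 < e\<close> by (intro bexI[of _ "{}"]) auto
  next
    case (insert x X)
    let ?S = "D \<inter> (\<Union>y\<in>X. W y)"
    show ?case
    proof (cases "t \<le> measure M ?S")
      case False
      have S: "?S \<in> fmeasurable M"
        using D insert.hyps W by (intro fmeasurableI2[OF Dm] sets.Int sets.finite_UN) auto
      have "t \<le> measure M (D \<inter> (\<Union>y\<in>insert x X. W y))"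
        by (rule insert.prems)
      also have "\<dots> \<le> measure M (?S \<union> W x)"
        using S D W insert.hyps
        by (intro measure_mono_fmeasurable fmeasurable.Un sets.Int sets.finite_UN) auto
      also have "\<dots> \<le> measure M ?S + measure M (W x)"
        using S W by (intro measure_Un_le) auto
      finally have "t - e / 2 < measure M ?S"
        using W(4)[of x] by linarith
      then show ?thesis
        using False S by (intro bexI[of _ ?S]) auto
    qed (use insert.IH in auto)
  qed
  moreover have "D \<inter> (\<Union>x\<in>X. W x) = D"
    using X D by auto
  ultimately obtain S where S: "S \<in> sets M" "S \<subseteq> D" "measure M S \<le> t" "t - e / 2 < measure M S"
    using t X by metis
  obtain C where C: "compact C" "C \<subseteq> S" "measure M S - e / 2 < measure M C"
    using haar_inner_regular[OF S(1) subset_trans[OF S(2) D(2)] \<open>compact K\<close>, of "e / 2"] \<open>0 < e\<close> by auto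
  have "measure M C \<le> measure M S"
    using C S Dm by (intro measure_mono_fmeasurable)
      (auto intro: fmeasurableI2[OF Dm] compact_haar[OF haar])
  then have "\<bar>measure M C - t\<bar> < e"
    using C S \<open>0 < e\<close> by (simp add: abs_less_iff)
  then show ?thesis
    using C S by blast
qed


text \<open>
  The sets \<open>U i\<close> are taken inside small neighbourhoods of points \<open>p i \<in> C i\<close> near which \<open>C i\<close> has
  positive measure. Since points are null, the \<open>p i\<close> can be chosen such that all points \<open>f + p i\<close>
  with \<open>f \<in> F\<close> are distinct; disjoint neighbourhoods of these finitely many points then keep the
  translates \<open>f + U i\<close> apart, for different \<open>f\<close> as well as for different \<open>i\<close>.
\<close>

lemma separated_translates:
  assumes "finite F" and "finite I"
    and C: "\<And>i. i \<in> I \<Longrightarrow> compact (C i)" "\<And>i. i \<in> I \<Longrightarrow> 0 < measure M (C i)"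
    and c: "\<And>i. i \<in> I \<Longrightarrow> 0 \<le> c i" "(\<Sum>i\<in>I. c i) = 1" and "0 < \<eta>"
  obtains U where "\<And>i. i \<in> I \<Longrightarrow> compact (U i)" "\<And>i. i \<in> I \<Longrightarrow> U i \<subseteq> C i"
    "disjoint_family_on (\<lambda>(f, i). (+) f ` U i) (F \<times> I)"
    "0 < (\<Sum>i\<in>I. measure M (U i))"
    "(\<Sum>i\<in>I. \<bar>measure M (U i) / (\<Sum>j\<in>I. measure M (U j)) - c i\<bar>) < \<eta>"
proof -
  have "\<exists>p. (\<forall>i\<in>I. \<forall>W. open W \<longrightarrow> p i \<in> W \<longrightarrow> 0 < measure M (C i \<inter> W)) \<and>
      (\<forall>i\<in>I. \<forall>j\<in>I. i \<noteq> j \<longrightarrow> (\<forall>f\<in>F. \<forall>g\<in>F. f + p i \<noteq> g + p j))"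
    using \<open>finite I\<close> C
  proof (induction I)
    case (insert i I)
    then obtain p where p: "\<And>j W. j \<in> I \<Longrightarrow> open W \<Longrightarrow> p j \<in> W \<Longrightarrow> 0 < measure M (C j \<inter> W)"
      "\<And>j k f g. j \<in> I \<Longrightarrow> k \<in> I \<Longrightarrow> j \<noteq> k \<Longrightarrow> f \<in> F \<Longrightarrow> g \<in> F \<Longrightarrow> f + p j \<noteq> g + p k"
      by (metis insertI2)
    \<comment> \<open>The positions of the new point at which one of its translates would meet an old one.\<close>
    let ?S = "\<Union>f\<in>F. \<Union>g\<in>F. \<Union>j\<in>I. {- f + (g + p j)}"
    obtain q where q: "q \<in> C i - ?S" "\<And>W. open W \<Longrightarrow> q \<in> W \<Longrightarrow> 0 < measure M (C i \<inter> W)"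
      using density_point[of "C i" ?S] insert.prems insert.hyps \<open>finite F\<close> by auto
    have q_new: "f + q \<noteq> g + p j" if "f \<in> F" "g \<in> F" "j \<in> I" for f g j
    proof
      assume "f + q = g + p j"
      then have "q = - f + (g + p j)"
        by (metis minus_add_cancel)
      then show False
        using q(1) that by blast
    qed
    show ?case
    proof (intro exI[of _ "p(i := q)"] conjI ballI allI impI)
      fix j W assume "j \<in> insert i I" "open W" "(p(i := q)) j \<in> W"
      then show "0 < measure M (C j \<inter> W)"
        using p(1) q(2) by (cases "j = i") auto
    next
      fix j k f g assume "j \<in> insert i I" "k \<in> insert i I" "j \<noteq> k" "f \<in> F" "g \<in> F"
      then show "f + (p(i := q)) j \<noteq> g + (p(i := q)) k"
        using p(2) q_new q_new[symmetric] by (cases "j = i"; cases "k = i") auto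
    qed
  qed simp
  then obtain p where density: "\<And>i W. i \<in> I \<Longrightarrow> open W \<Longrightarrow> p i \<in> W \<Longrightarrow> 0 < measure M (C i \<inter> W)"
    and distinct: "\<And>i j f g. i \<in> I \<Longrightarrow> j \<in> I \<Longrightarrow> i \<noteq> j \<Longrightarrow> f \<in> F \<Longrightarrow> g \<in> F \<Longrightarrow> f + p i \<noteq> g + p j"
    by metis
  obtain Q where Q: "\<And>f i. f \<in> F \<Longrightarrow> i \<in> I \<Longrightarrow> open (Q (f + p i))"
      "\<And>f i. f \<in> F \<Longrightarrow> i \<in> I \<Longrightarrow> f + p i \<in> Q (f + p i)"
    and Q_disj: "disjoint_family_on Q ((\<lambda>(f, i). f + p i) ` (F \<times> I))"
    using separate_finite[of "(\<lambda>(f, i). f + p i) ` (F \<times> I)"] \<open>finite F\<close> \<open>finite I\<close> by auto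
  define V where "V i = (\<Inter>f\<in>F. (+) (- f) ` Q (f + p i))" for i
  have V: "open (V i)" "p i \<in> V i" if "i \<in> I" for i
  proof -
    show "open (V i)"
      unfolding V_def using that Q(1) \<open>finite F\<close> by (intro open_INT ballI open_translate)
    show "p i \<in> V i"
      unfolding V_def using that Q(2) by (auto simp: image_iff intro!: bexI[of _ "_ + p i"])
  qed
  define D where "D i = C i \<inter> V i" for i
  have D: "D i \<in> sets M" "D i \<subseteq> C i" "0 < measure M (D i)" if "i \<in> I" for i
    using that C(1) V density compact_haar[OF haar] open_haar[OF haar] by (auto simp: D_def)
  have "I \<noteq> {}"
    using c(2) by auto
  \<comment> \<open>As \<open>c i \<le> 1\<close>, every \<open>D i\<close> has room for a subset of measure \<open>\<delta> * c i\<close>.\<close>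
  define \<delta> where "\<delta> = Min ((\<lambda>i. measure M (D i)) ` I)"
  have \<delta>: "0 < \<delta>" "\<And>i. i \<in> I \<Longrightarrow> \<delta> \<le> measure M (D i)"
    using \<open>finite I\<close> \<open>I \<noteq> {}\<close> D(3) by (auto simp: \<delta>_def)
  define e where "e = \<delta> * min (1 / 2) (\<eta> / 4) / card I"
  have "0 < e"
    using \<open>finite I\<close> \<open>I \<noteq> {}\<close> \<open>0 < \<delta>\<close> \<open>0 < \<eta>\<close> by (simp add: e_def card_gt_0_iff)
  have "\<exists>U. compact U \<and> U \<subseteq> D i \<and> \<bar>measure M U - \<delta> * c i\<bar> < e" if i: "i \<in> I" for i
  proof (rule compact_subset_of_measure[OF D(1)[OF i] D(2)[OF i] C(1)[OF i] _ _ \<open>0 < e\<close>])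
    have "c i \<le> 1"
      using member_le_sum[of i I c] c i \<open>finite I\<close> by simp
    then have "\<delta> * c i \<le> \<delta>"
      using \<open>0 < \<delta>\<close> by (simp add: mult_left_le)
    then show "\<delta> * c i \<le> measure M (D i)"
      using \<delta>(2)[OF i] by linarith
    show "0 \<le> \<delta> * c i"
      using \<open>0 < \<delta>\<close> c(1)[OF i] by simp
  qed
  then obtain U where U: "\<And>i. i \<in> I \<Longrightarrow> compact (U i)" "\<And>i. i \<in> I \<Longrightarrow> U i \<subseteq> D i"
      "\<And>i. i \<in> I \<Longrightarrow> \<bar>measure M (U i) - \<delta> * c i\<bar> < e"
    by metis
  have in_Q: "(+) f ` U i \<subseteq> Q (f + p i)" if "f \<in> F" "i \<in> I" for f i
  proof -
    have "U i \<subseteq> (+) (- f) ` Q (f + p i)"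
      using U(2)[OF that(2)] that(1) by (auto simp: D_def V_def)
    then show ?thesis
      by force
  qed
  have disj: "(+) f ` U i \<inter> (+) g ` U j = {}"
    if "f \<in> F" "g \<in> F" "i \<in> I" "j \<in> I" "(f, i) \<noteq> (g, j)" for f g i j
  proof -
    have "f + p i \<noteq> g + p j"
      using that distinct by (cases "i = j") auto
    moreover have "h + p k \<in> (\<lambda>(f, i). f + p i) ` (F \<times> I)" if "h \<in> F" "k \<in> I" for h k
      using that by (intro image_eqI[of _ _ "(h, k)"]) auto
    ultimately have "Q (f + p i) \<inter> Q (g + p j) = {}"
      using disjoint_family_onD[OF Q_disj] that by simp
    then show ?thesis
      using in_Q[OF that(1,3)] in_Q[OF that(2,4)] by blast
  qed
  show ?thesis
  proof (rule that[of U])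
    show "U i \<subseteq> C i" if "i \<in> I" for i
      using U(2)[OF that] D(2)[OF that] by blast
    show "disjoint_family_on (\<lambda>(f, i). (+) f ` U i) (F \<times> I)"
      unfolding disjoint_family_on_def using disj by (simp add: split_beta)
    show "0 < (\<Sum>i\<in>I. measure M (U i))"
      using normalized_approximation(1)[OF \<open>finite I\<close> c \<open>0 < \<delta>\<close> \<open>0 < \<eta>\<close>] U(3) by (simp add: e_def)
    show "(\<Sum>i\<in>I. \<bar>measure M (U i) / (\<Sum>j\<in>I. measure M (U j)) - c i\<bar>) < \<eta>"
      using normalized_approximation(2)[OF \<open>finite I\<close> c \<open>0 < \<delta>\<close> \<open>0 < \<eta>\<close>] U(3) by (simp add: e_def)
  qed (fact U(1))
qed

end

end

section \<open>Invariant means as limits of Folner nets\<close>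

text \<open>
  Averaging over a discrete Folner set \<open>F\<close> does not change \<open>\<mu>(E)\<close>, but it replaces the indicator
  of \<open>E\<close> by the proportion of \<open>f \<in> F\<close> with \<open>f + y \<in> E\<close>, which is constant on each of the
  finitely many level sets \<open>Y v\<close>. Small pieces \<open>U v \<subseteq> Y v\<close> with measures proportional to \<open>\<mu>(Y v)\<close>
  thus reproduce \<open>\<mu>(E)\<close> for all \<open>E\<close> in the partition at once, whatever their positions and shapes.
\<close>

lemma LIM_subset_LIM0:
  fixes M :: "'a::{topological_group_add, t2_space} measure"
  assumes haar: "left_haar_measure M"
    and points: "\<And>x. {x} \<in> null_sets M"
    and amenable: "amenable_as_discrete TYPE('a)"
  shows "LIM_set M \<subseteq> LIM0_set M"
proof
  fix \<mu> assume \<mu>: "\<mu> \<in> LIM_set M"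
  define m where "m E = \<mu> (indicat_real E)" for E
  interpret sigma_algebra UNIV "locally_measurable_sets M"
    by (rule sigma_algebra_locally_measurable[OF haar])
  have m: "invariant_charge (locally_measurable_sets M) m"
    using invariant_charge_LIM[OF haar \<mu>] by (simp add: m_def[abs_def])
  have m_null: "m E = 0" if E: "E \<in> locally_measurable_sets M" "E \<in> locally_null_sets M" for E
  proof -
    have *: "\<forall>\<phi>\<in>L_infty M. \<forall>\<psi>\<in>L_infty M.
        {x. \<phi> x \<noteq> \<psi> x} \<in> locally_null_sets M \<longrightarrow> \<mu> \<phi> = \<mu> \<psi>"
      using \<mu> by (simp add: LIM_set_def left_invariant_means_def means_def linear_functionals_def)
    have "{x. indicat_real E x \<noteq> indicat_real {} x} = E"
      by (simp add: indicator_eq_0_iff)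
    then have "m E = m {}"
      using *[rule_format, of "indicat_real E" "indicat_real {}"] E
      by (simp only: m_def indicator_L_infty[OF haar] empty_sets)
    also have "\<dots> = 0"
      using charge_UN[OF m, of "{} :: nat set" "\<lambda>_. {}"] by (simp add: disjoint_family_on_def)
    finally show ?thesis .
  qed
  have "\<exists>A\<in>Folner_sets M K \<epsilon>. set_mean M A \<in> mean_nhd M \<mu> P \<epsilon>"
    if \<epsilon>: "\<epsilon> \<in> {0<..<1}" and P: "finite_measurable_partition M P" and "finite K" for P K \<epsilon>
  proof -
    have "finite P" and P_sets: "\<And>E. E \<in> P \<Longrightarrow> E \<in> locally_measurable_sets M"
      using P by (auto simp: finite_measurable_partition_def)
    obtain m' :: "'a set \<Rightarrow> real" where "invariant_charge UNIV m'"
      using amenable_as_discrete_charge[OF amenable] by blast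
    then obtain F where F: "finite F" "F \<noteq> {}"
      and folner: "\<And>x. x \<in> K \<Longrightarrow> card (sym_diff ((+) x ` F) F) < \<epsilon> * card F"
      using discrete_folner_set[of m' K \<epsilon>] \<open>finite K\<close> \<epsilon> by auto
    have card_F: "0 < card F"
      using F by (simp add: card_gt_0_iff)

    \<comment> \<open>The level sets of \<open>y \<mapsto> pattern y\<close> form a finite partition that refines all \<open>T f E\<close>.\<close>
    define pattern where "pattern y = {(f, E). f \<in> F \<and> E \<in> P \<and> f + y \<in> E}" for y
    define Y where "Y v = {y. pattern y = v}" for v
    define T where "T f E = {y. f + y \<in> E}" for f :: 'a and E
    have T_eq: "T f E = (+) (- f) ` E" for f E
      by (simp add: T_def translate_eq_vimage vimage_def)
    have T_sets: "T f E \<in> locally_measurable_sets M" if "E \<in> P" for f E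
      unfolding T_eq by (rule translate_locally_measurable[OF haar P_sets[OF that]])
    have m_T: "m (T f E) = m E" if "E \<in> P" for f E
      using m P_sets[OF that] unfolding T_eq invariant_charge_def by blast
    have "pattern y \<in> Pow (F \<times> P)" for y
      by (auto simp: pattern_def)
    then have fin_pat: "finite (range pattern)"
      using \<open>finite P\<close> F(1) by (intro finite_subset[of "range pattern" "Pow (F \<times> P)"]) auto
    have Y_sets: "Y v \<in> locally_measurable_sets M" if "v \<in> range pattern" for v
    proof -
      have "v \<subseteq> F \<times> P"
        using that by (auto simp: pattern_def)
      then have "pattern y = v \<longleftrightarrow> (\<forall>f\<in>F. \<forall>E\<in>P. f + y \<in> E \<longleftrightarrow> (f, E) \<in> v)" for y
        unfolding pattern_def by blast
      then have "Y v = UNIV - (\<Union>(f, E)\<in>F \<times> P. if (f, E) \<in> v then UNIV - T f E else T f E)"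
        by (auto simp: Y_def T_def split: if_splits)
      also have "\<dots> \<in> locally_measurable_sets M"
      proof (intro compl_sets finite_UN)
        fix i assume "i \<in> F \<times> P"
        then show "(case i of (f, E) \<Rightarrow> if (f, E) \<in> v then UNIV - T f E else T f E)
            \<in> locally_measurable_sets M"
          using T_sets compl_sets by (cases i) simp
      qed (use F(1) \<open>finite P\<close> in simp)
      finally show ?thesis .
    qed

    \<comment> \<open>Locally null level sets carry no mass and contain no compact set of positive measure.\<close>
    define I where "I = {v \<in> range pattern. Y v \<notin> locally_null_sets M}"
    define c where "c v = m (Y v)" for v
    have "finite I"
      using fin_pat by (simp add: I_def)
    have c_nonneg: "0 \<le> c v" if "v \<in> I" for v
      using m Y_sets that by (auto simp: invariant_charge_def c_def I_def)
    have sum_c_pat: "m {y. Q (pattern y)} = (\<Sum>v\<in>I. of_bool (Q v) * c v)" for Q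
    proof -
      have "{y. Q (pattern y)} = (\<Union>v\<in>{v \<in> range pattern. Q v}. Y v)"
        by (auto simp: Y_def)
      also have "m \<dots> = (\<Sum>v\<in>{v \<in> range pattern. Q v}. c v)"
        unfolding c_def using fin_pat Y_sets
        by (intro charge_UN[OF m]) (auto simp: disjoint_family_on_def Y_def)
      also have "\<dots> = (\<Sum>v\<in>{v \<in> I. Q v}. c v)"
        using fin_pat m_null Y_sets by (intro sum.mono_neutral_right) (auto simp: I_def c_def)
      also have "\<dots> = (\<Sum>v\<in>I. of_bool (Q v) * c v)"
        using \<open>finite I\<close> by (simp add: sum.If_cases of_bool_def Int_def if_distrib[of "\<lambda>z. z * _"] cong: if_cong)
      finally show ?thesis .
    qed
    have sum_c: "(\<Sum>v\<in>I. c v) = 1"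
      using sum_c_pat[of "\<lambda>_. True"] m by (simp add: invariant_charge_def)
    have m_eq: "m E = (\<Sum>v\<in>I. of_bool ((f, E) \<in> v) * c v)" if "E \<in> P" "f \<in> F" for E f
    proof -
      have "{y. (f, E) \<in> pattern y} = T f E"
        using that by (auto simp: pattern_def T_def)
      then show ?thesis
        using sum_c_pat[of "\<lambda>v. (f, E) \<in> v"] m_T[OF that(1)] by simp
    qed

    have "\<exists>C. compact C \<and> C \<subseteq> Y v \<and> 0 < measure M C" if "v \<in> I" for v
      using compact_subset_of_nonnull[OF haar Y_sets] that by (auto simp: I_def)
    then obtain C where C: "\<And>v. v \<in> I \<Longrightarrow> compact (C v)" "\<And>v. v \<in> I \<Longrightarrow> C v \<subseteq> Y v"
        "\<And>v. v \<in> I \<Longrightarrow> 0 < measure M (C v)"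
      by metis
    obtain U where U: "\<And>v. v \<in> I \<Longrightarrow> compact (U v)" "\<And>v. v \<in> I \<Longrightarrow> U v \<subseteq> C v"
      and U_disj: "disjoint_family_on (\<lambda>(f, v). (+) f ` U v) (F \<times> I)"
      and U_pos: "0 < (\<Sum>v\<in>I. measure M (U v))"
      and U_approx: "(\<Sum>v\<in>I. \<bar>measure M (U v) / (\<Sum>w\<in>I. measure M (U w)) - c v\<bar>) < \<epsilon>"
    proof (rule separated_translates[where C = C and c = c and \<eta> = \<epsilon>,
          OF haar points F(1) \<open>finite I\<close> C(1,3) c_nonneg sum_c])
      show "0 < \<epsilon>"
        using \<epsilon> by simp
    qed (assumption+, rule that)
    define u where "u v = measure M (U v)" for v
    define s where "s = (\<Sum>v\<in>I. u v)"
    have "0 < s" and approx: "(\<Sum>v\<in>I. \<bar>u v / s - c v\<bar>) < \<epsilon>"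
      using U_pos U_approx by (simp_all add: s_def u_def)
    have fU: "(+) f ` U v \<in> fmeasurable M" "measure M ((+) f ` U v) = u v" if "v \<in> I" for f v
      using U(1)[OF that] fmeasurable_compact[OF haar] compact_haar[OF haar] measure_translate[OF haar]
      by (auto simp: compact_translate u_def)
    have measure_UN: "measure M (\<Union>(f, v)\<in>J. (+) f ` U v) = (\<Sum>(f, v)\<in>J. u v)" if J: "J \<subseteq> F \<times> I" for J
    proof -
      have "measure M (\<Union>(f, v)\<in>J. (+) f ` U v) = (\<Sum>i\<in>J. measure M (case i of (f, v) \<Rightarrow> (+) f ` U v))"
      proof (rule measure_finite_Union)
        show "finite J"
          using J F(1) \<open>finite I\<close> by (meson finite_SigmaI finite_subset)
        show "disjoint_family_on (\<lambda>(f, v). (+) f ` U v) J"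
          using U_disj J by (rule disjoint_family_on_mono[rotated])
        show "(\<lambda>(f, v). (+) f ` U v) ` J \<subseteq> sets M"
          using J fU(1) by (auto dest: fmeasurableD)
        fix i assume "i \<in> J"
        then show "emeasure M (case i of (f, v) \<Rightarrow> (+) f ` U v) \<noteq> \<infinity>"
          using J fU(1) by (auto simp: fmeasurable_def less_top)
      qed
      also have "\<dots> = (\<Sum>(f, v)\<in>J. u v)"
        using J fU(2) by (intro sum.cong) auto
      finally show ?thesis .
    qed

    \<comment> \<open>A union of disjoint copies of \<open>F\<close>, so it inherits the invariance of \<open>F\<close>.\<close>
    define A where "A = (\<Union>(f, v)\<in>F \<times> I. (+) f ` U v)"
    have "compact A"
      unfolding A_def using F(1) \<open>finite I\<close> U(1) by (intro compact_UN) (auto intro: compact_translate)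
    have measure_A: "measure M A = card F * s"
      unfolding A_def by (simp add: measure_UN s_def flip: sum.cartesian_product)
    then have "0 < measure M A"
      using \<open>0 < s\<close> card_F by simp

    have "measure M (sym_diff ((+) x ` A) A) / measure M A < \<epsilon>" if "x \<in> K" for x
    proof -
      let ?D = "sym_diff ((+) x ` F) F"
      have "finite ?D"
        using F(1) by simp
      have "(+) x ` F \<times> I = (\<lambda>(f, v). (x + f, v)) ` (F \<times> I)"
        by auto
      then have xA: "(+) x ` A = (\<Union>(f, v)\<in>(+) x ` F \<times> I. (+) f ` U v)"
        by (simp add: A_def image_UN image_image split_beta add.assoc)
      have "(\<Union>(f, v)\<in>X \<times> I. (+) f ` U v) - (\<Union>(f, v)\<in>Z \<times> I. (+) f ` U v) \<subseteq>
          (\<Union>(f, v)\<in>(X - Z) \<times> I. (+) f ` U v)" for X Z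
        by blast
      from this[of "(+) x ` F" F] this[of F "(+) x ` F"]
      have "sym_diff ((+) x ` A) A \<subseteq> (\<Union>(f, v)\<in>?D \<times> I. (+) f ` U v)"
        unfolding xA unfolding A_def by blast
      then have "measure M (sym_diff ((+) x ` A) A) \<le> measure M (\<Union>(f, v)\<in>?D \<times> I. (+) f ` U v)"
        using \<open>finite ?D\<close> \<open>finite I\<close> fU(1) \<open>compact A\<close> compact_haar[OF haar] compact_translate[of A x]
        by (intro measure_mono_fmeasurable fmeasurable.finite_UN sets.Un sets.Diff) auto
      also have "\<dots> \<le> (\<Sum>i\<in>?D \<times> I. measure M (case i of (f, v) \<Rightarrow> (+) f ` U v))"
        using \<open>finite ?D\<close> \<open>finite I\<close> fU(1) by (intro measure_UNION_le) (auto dest: fmeasurableD)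
      also have "\<dots> = (\<Sum>(f, v)\<in>?D \<times> I. u v)"
        using fU(2) by (intro sum.cong) auto
      also have "\<dots> = card ?D * s"
        by (simp add: s_def flip: sum.cartesian_product)
      also have "\<dots> < \<epsilon> * card F * s"
        using folner[OF that] \<open>0 < s\<close> by (intro mult_strict_right_mono)
      finally show ?thesis
        using \<open>0 < measure M A\<close> by (simp add: pos_divide_less_eq measure_A mult.assoc)
    qed
    then have "A \<in> Folner_sets M K \<epsilon>"
      using \<open>compact A\<close> \<open>0 < measure M A\<close> by (simp add: Folner_sets_def)

    moreover have "\<bar>m E - set_mean M A (indicat_real E)\<bar> < \<epsilon>" if E: "E \<in> P" for E
    proof -
      let ?J = "{(f, v) \<in> F \<times> I. (f, E) \<in> v}"
      \<comment> \<open>The translate \<open>f + U v\<close> lies inside \<open>E\<close> or is disjoint from it.\<close>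
      have "f + y \<in> E \<longleftrightarrow> (f, E) \<in> v" if "f \<in> F" "v \<in> I" "y \<in> U v" for f v y
        using U(2)[OF that(2)] C(2)[OF that(2)] that E by (auto simp: Y_def pattern_def)
      then have AE: "A \<inter> E = (\<Union>(f, v)\<in>?J. (+) f ` U v)"
        by (fastforce simp: A_def)
      then have "measure M (A \<inter> E) = (\<Sum>(f, v)\<in>?J. u v)"
        by (simp only:) (rule measure_UN, auto)
      also have "\<dots> = (\<Sum>(f, v)\<in>F \<times> I. of_bool ((f, E) \<in> v) * u v)"
        using F(1) \<open>finite I\<close> by (intro sum.mono_neutral_cong_left) auto
      also have "\<dots> = (\<Sum>f\<in>F. \<Sum>v\<in>I. of_bool ((f, E) \<in> v) * u v)"
        by (simp add: sum.cartesian_product)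
      finally have measure_AE: "measure M (A \<inter> E) = (\<Sum>f\<in>F. \<Sum>v\<in>I. of_bool ((f, E) \<in> v) * u v)" .
      have "?J \<subseteq> F \<times> I"
        by auto
      then have "A \<inter> E \<in> sets M"
        unfolding AE using F(1) \<open>finite I\<close> fU(1)
        by (intro sets.finite_UN) (auto dest: fmeasurableD intro: finite_subset)
      then have "set_mean M A (indicat_real E) = measure M (A \<inter> E) / (card F * s)"
        using set_mean_indicator[OF haar \<open>compact A\<close> P_sets[OF E]] measure_A by simp
      then have "card F * (set_mean M A (indicat_real E) - m E) =
          (\<Sum>f\<in>F. \<Sum>v\<in>I. of_bool ((f, E) \<in> v) * u v) / s - (\<Sum>f\<in>F. m E)"
        using card_F by (simp add: measure_AE algebra_simps)
      also have "\<dots> = (\<Sum>f\<in>F. \<Sum>v\<in>I. of_bool ((f, E) \<in> v) * (u v / s - c v))"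
        using m_eq[OF E]
        by (simp add: sum_divide_distrib sum_subtractf right_diff_distrib cong: sum.cong)
      finally have "card F * \<bar>set_mean M A (indicat_real E) - m E\<bar> =
          \<bar>\<Sum>f\<in>F. \<Sum>v\<in>I. of_bool ((f, E) \<in> v) * (u v / s - c v)\<bar>"
        by (metis abs_mult abs_of_nat)
      also have "\<dots> \<le> (\<Sum>f\<in>F. \<Sum>v\<in>I. \<bar>u v / s - c v\<bar>)"
        by (intro order_trans[OF sum_abs] sum_mono) (auto simp: abs_mult)
      also have "\<dots> < card F * \<epsilon>"
        using approx card_F by simp
      finally show ?thesis
        using card_F by (simp add: abs_minus_commute)
    qed
    then have "set_mean M A \<in> mean_nhd M \<mu> P \<epsilon>"
      using set_mean_in_Means[OF haar \<open>compact A\<close> \<open>0 < measure M A\<close>]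
      by (simp add: mean_nhd_def m_def)
    ultimately show ?thesis
      by blast
  qed
  then show "\<mu> \<in> LIM0_set M"
    using \<mu> by (simp add: LIM0_set_def)
qed

theorem mainTheorem14:
  fixes M :: "'a::{topological_group_add, t2_space} measure"
  assumes "locally_compact_space (euclidean :: 'a topology)"
    and "left_haar_measure M"
    and "(euclidean :: 'a topology) \<noteq> discrete_topology UNIV"
    and "amenable_as_discrete TYPE('a)"
  shows "LIM0_set M = LIM_set M"
proof
  show "LIM0_set M \<subseteq> LIM_set M"
    by (auto simp: LIM0_set_def)
  show "LIM_set M \<subseteq> LIM0_set M"
    using assms by (intro LIM_subset_LIM0 points_null)
qed

end
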